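(* Assume that $f$ is $\sigma$-strongly convex and $\beta$-smooth (i.e. $\nabla f$ is $\beta$-Lipschitz), with $0<\sigma\le\beta$, and that $g$ is proper, closed, and convex. Fix $\gamma>0$ and $\alpha>0$, and let $$\delta:=\max\left\{\frac{\gamma\beta-1}{\gamma\beta+1},\frac{1-\gamma\sigma}{1+\gamma\sigma}\right\},\qquad \rho:=|1-\alpha|+\alpha\delta,$$ and assume $\rho<1$. Run the certified CR-DRS algorithm described in the context. With $m:=1+\gamma\sigma$ and $L:=1+\gamma\beta$, define $$\theta_G:=\frac{L-m}{L+m},\qquad \theta:=\max\{\theta_Q,\theta_G^b\},\qquad L_p:=\frac1m,\qquad c:=2\alpha .$$ If $$\theta<\frac{1-\rho}{(1-\rho)(1+cL_p)+cL_p(1+\rho)},\qquad (\ast)$$ then the state $z_k$ converges $R$-linearly to the unique fixed point $z_\star$ of the exact DRS map $T=(1-\alpha)I+\alpha R_{\gamma g}R_{\gamma f}$, and the approximate proximal points $x_k$ converge $R$-linearly to the unique minimizer $x_\star=P_{\gamma f}z_\star$ of $f+g$. More precisely, with $A_k:=\|z_k-z_\star\|$ and $E_k:=\|x_k-P_{\gamma f}z_k\|$, we have for every $k\ge0$ the componentwise inequality $$\begin{bmatrix} A_{k+1} \\ E_{k+1} \end{bmatrix}\le M\begin{bmatrix} A_k \\ E_k \end{bmatrix},\qquad M:=\begin{bmatrix}\rho & c \\ \theta L_p(1+\rho) & \theta(1+cL_p)\end{bmatrix},$$ and condition $(\ast)$ is equivalent to $\varrho(M)<1$, where $\varrho(M)$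 is the spectral radius of $M$.
   Context: Setting and notation. $\mathcal H$ is a finite-dimensional real Hilbert space, $f:\mathcal H\to\mathbb R$ is convex and twice continuously differentiable, $g:\mathcal H\to\mathbb R\cup\{+\infty\}$ is proper, closed, convex. For a proper closed convex $h$ and $\gamma>0$, $P_{\gamma h}u:=\arg\min_x\{\gamma h(x)+\frac12\|x-u\|^2\}$ and $R_{\gamma h}:=2P_{\gamma h}-I$. For a center $z_k$ put $\phi_k(x):=\gamma f(x)+\frac12\|x-z_k\|^2$ and $r_k(x):=\nabla\phi_k(x)=\gamma\nabla f(x)+x-z_k$. A sequence $u_k$ converges $R$-linearly to $u_\star$ if $\|u_k-u_\star\|\le Cq^k$ for some $C>0$, $q\in(0,1)$. For vectors $a,b$, $ab^\top$ is the operator $h\mapsto\langle b,h\rangle a$. Certified CR-DRS algorithm. Parameters: $\gamma>0$, $\alpha>0$, integers $K\ge0$ and $b\ge1$, memory cap $m_q\in\{1,2,\dots\}\cup\{\infty\}$, $c_A\in(0,1/2)$, $\theta_Q\in(0,1)$, $\nu_{\rm qn}\in(0,2)$, $\bar\eta\in(0,1]$, $\epsilon_{\rm curv}\in[0,1)$, $\epsilon_{\rm sr1}\in(0,1)$, $0<\underline h\le\overline h<\infty$, $\vartheta_0\in[\underline h,\overline h]$, and an update type (BFGS or SR1). $m:=1+\gamma\sigma$, $L:=1+\gamma\beta$. Inputs: $z_0,a_{-1}\in\mathcal H$ and an initial ordered memory $\mathcal M_0$ of at most $m_q$ accepted exact secant pairs. An exact secant pair is $(s,q)$ with $s=v-u$,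 $q=\gamma(\nabla f(v)-\nabla f(u))+s$. For $k=0,1,2,\dots$: 1. Set $\bar r_k:=r_k(a_{k-1})=\gamma\nabla f(a_{k-1})+a_{k-1}-z_k$. 2. Build self-adjoint positive definite $H_k$ and $B_k=H_k^{-1}$: start from $H=\vartheta_kI$, $B=\vartheta_k^{-1}I$, where $\vartheta_k=\min\{\overline h,\max\{\underline h,\langle s_\ell,q_\ell\rangle/\|q_\ell\|^2\}\}$ with $(s_\ell,q_\ell)$ the newest pair of $\mathcal M_k$ (and $\vartheta_k=\vartheta_0$ if $\mathcal M_k=\emptyset$); then process the pairs $(s,y)$ of $\mathcal M_k$ in chronological order. BFGS: with $\omega=1/\langle s,y\rangle$ ($\langle s,y\rangle>0$) and $V=I-\omega sy^\top$, $H^+=VHV^\top+\omega ss^\top$, $B^+=B-\frac{Bss^\top B}{\langle s,Bs\rangle}+\frac{yy^\top}{\langle s,y\rangle}$. Safeguarded SR1: with $u=s-Hy$, $v=y-Bs$ and nonzero denominators, $H^+=H+\frac{uu^\top}{\langle u,y\rangle}$, $B^+=B+\frac{vv^\top}{\langle v,s\rangle}$, performed only if $|\langle u,y\rangle|\ge\epsilon_{\rm sr1}\|u\|\|y\|$, $\underline hI\preceq H^+\preceq\overline hI$ and $\overline h^{-1}I\preceq B^+\preceq\underline h^{-1}I$; otherwise the pair is skipped. 3. Predictor: $\widetilde x_{k,0}=a_{k-1}$, $\widetilde r_{k,0}=\bar r_k$. For $j=0,\dots,K-1$: $d_{k,j}=-H_k\widetilde r_{k,j}$; $\eta_{k,j}=\min\{\bar\eta,\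 \nu_{\rm qn}\frac{-\langle\widetilde r_{k,j},d_{k,j}\rangle}{\langle d_{k,j},B_kd_{k,j}\rangle}\}$ if $d_{k,j}\ne0$, $\langle\widetilde r_{k,j},d_{k,j}\rangle<0$ and $\langle d_{k,j},B_kd_{k,j}\rangle>0$, and $\eta_{k,j}=0$ otherwise (then all later pseudo-states equal the current one); $\widetilde x_{k,j+1}=\widetilde x_{k,j}+\eta_{k,j}d_{k,j}$; $\widetilde r_{k,j+1}=\widetilde r_{k,j}+B_k(\widetilde x_{k,j+1}-\widetilde x_{k,j})$. Candidate: $\widehat x_k=\widetilde x_{k,K}$ ($=a_{k-1}$ if $K=0$). 4. Accept, $x_k:=\widehat x_k$, if all three tests hold: $\langle\bar r_k,\widehat x_k-a_{k-1}\rangle<0$; $\phi_k(\widehat x_k)\le\phi_k(a_{k-1})+c_A\langle\bar r_k,\widehat x_k-a_{k-1}\rangle$; $\|r_k(\widehat x_k)\|\le\frac mL\theta_Q\|\bar r_k\|$. 5. Otherwise (fallback) set $u_0=a_{k-1}$, $u_{j+1}=u_j-\tau_Gr_k(u_j)$ with $\tau_G=\frac{2}{m+L}$ for $j=0,\dots,b-1$, and $x_k:=u_b$. 6. Memory: $\mathcal M_{k+1}$ is $\mathcal M_k$ with $(s_k,q_k)=(x_k-a_{k-1},\,r_k(x_k)-\bar r_k)$ appended only if $\langle s_k,q_k\rangle\ge\epsilon_{\rm curv}\|s_k\|\|q_k\|$ and the safeguards of the chosen update hold; the oldest pair is discarded if the memory would exceed $m_q$. 7. $y_k^g=P_{\gamma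 g}(2x_k-z_k)$, $z_{k+1}=z_k+2\alpha(y_k^g-x_k)$, and $a_k:=x_k$. *)

theory Defs
  imports "HOL-Analysis.Analysis" "HOL-Library.Extended_Nat"
    "Jordan_Normal_Form.Spectral_Radius"
begin

text \<open>Leaves \<open>\<bullet>\<close> to the inner product of \<^class>\<open>real_inner\<close>.\<close>

no_notation scalar_prod (infix "\<bullet>" 70)

section \<open>Convex functions and proximal maps\<close>

definition grad :: "('a::real_inner \<Rightarrow> real) \<Rightarrow> 'a \<Rightarrow> 'a" where
  "grad f x = (THE D. GDERIV f x :> D)"

definition twice_continuously_differentiable :: "('a::real_normed_vector \<Rightarrow> real) \<Rightarrow> bool" where
  "twice_continuously_differentiable f \<longleftrightarrow>
    (\<exists>(f' :: 'a \<Rightarrow> 'a \<Rightarrow>\<^sub>L real) (f'' :: 'a \<Rightarrow> 'a \<Rightarrow>\<^sub>L 'a \<Rightarrow>\<^sub>L real).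
      (\<forall>x. (f has_derivative blinfun_apply (f' x)) (at x)) \<and>
      (\<forall>x. (f' has_derivative blinfun_apply (f'' x)) (at x)) \<and>
      continuous_on UNIV f'')"

definition strongly_convex :: "real \<Rightarrow> ('a::real_inner \<Rightarrow> real) \<Rightarrow> bool" where
  "strongly_convex \<sigma> f \<longleftrightarrow>
    (\<forall>x y t. 0 \<le> t \<and> t \<le> 1 \<longrightarrow>
      f (t *\<^sub>R x + (1 - t) *\<^sub>R y)
        \<le> t * f x + (1 - t) * f y - \<sigma> / 2 * t * (1 - t) * (norm (x - y))\<^sup>2)"

text \<open>The library's \<^const>\<open>epigraph\<close> only covers real-valued functions.\<close>

definition ext_epigraph :: "('a \<Rightarrow> ereal) \<Rightarrow> ('a \<times> real) set" where
  "ext_epigraph g = {(x, r). g x \<le> ereal r}"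

definition proper_closed_convex :: "('a::real_inner \<Rightarrow> ereal) \<Rightarrow> bool" where
  "proper_closed_convex g \<longleftrightarrow>
    (\<forall>x. g x \<noteq> -\<infinity>) \<and> (\<exists>x. g x \<noteq> \<infinity>) \<and>
    closed (ext_epigraph g) \<and> convex (ext_epigraph g)"

definition prox :: "real \<Rightarrow> ('a::real_inner \<Rightarrow> ereal) \<Rightarrow> 'a \<Rightarrow> 'a" where
  "prox \<gamma> h u = (ARG_MIN (\<lambda>x. ereal \<gamma> * h x + ereal ((norm (x - u))\<^sup>2 / 2)) x. True)"

definition refl_prox :: "real \<Rightarrow> ('a::real_inner \<Rightarrow> ereal) \<Rightarrow> 'a \<Rightarrow> 'a" where
  "refl_prox \<gamma> h u = 2 *\<^sub>R prox \<gamma> h u - u"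

definition drs_map ::
    "real \<Rightarrow> real \<Rightarrow> ('a::real_inner \<Rightarrow> real) \<Rightarrow> ('a \<Rightarrow> ereal) \<Rightarrow> 'a \<Rightarrow> 'a" where
  "drs_map \<gamma> \<alpha> f g z =
    (1 - \<alpha>) *\<^sub>R z + \<alpha> *\<^sub>R refl_prox \<gamma> g (refl_prox \<gamma> (\<lambda>x. ereal (f x)) z)"

definition R_linear :: "(nat \<Rightarrow> 'a::real_normed_vector) \<Rightarrow> 'a \<Rightarrow> bool" where
  "R_linear u l \<longleftrightarrow> (\<exists>C>0. \<exists>q. 0 < q \<and> q < 1 \<and> (\<forall>k. norm (u k - l) \<le> C * q ^ k))"

section \<open>The certified CR-DRS algorithm\<close>

datatype update_type = BFGS | SR1

text \<open>\<open>sc\<close> and \<open>sm\<close> are the strong convexity and smoothness constants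
  (written \<open>\<sigma>\<close>, \<open>\<beta>\<close>) of \<open>f\<close>; the algorithm uses them through \<open>m\<close> and \<open>L\<close>.\<close>

record crdrs_params =
  sc :: real
  sm :: real
  gam :: real
  relax :: real
  pred_steps :: nat
  fb_steps :: nat
  mem_cap :: enat
  armijo :: real
  theta_Q :: real
  nu_qn :: real
  eta_bar :: real
  eps_curv :: real
  eps_sr1 :: real
  h_lo :: real
  h_hi :: real
  vth_0 :: real
  upd :: update_type

definition m_const :: "crdrs_params \<Rightarrow> real" where
  "m_const P = 1 + gam P * sc P"

definition L_const :: "crdrs_params \<Rightarrow> real" where
  "L_const P = 1 + gam P * sm P"

definition phi :: "crdrs_params \<Rightarrow> ('a::euclidean_space \<Rightarrow> real) \<Rightarrow> 'a \<Rightarrow> 'a \<Rightarrow> real" where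
  "phi P f zk x = gam P * f x + (norm (x - zk))\<^sup>2 / 2"

definition res :: "crdrs_params \<Rightarrow> ('a::euclidean_space \<Rightarrow> real) \<Rightarrow> 'a \<Rightarrow> 'a \<Rightarrow> 'a" where
  "res P f zk x = gam P *\<^sub>R grad f x + x - zk"

subsection \<open>Quasi-Newton operators\<close>

text \<open>\<open>rank_one a b\<close> is the operator written \<open>a b\<^sup>T\<close>.\<close>

definition rank_one :: "'a::euclidean_space \<Rightarrow> 'a \<Rightarrow> 'a \<Rightarrow>\<^sub>L 'a" where
  "rank_one a b = blinfun_scaleR_left a o\<^sub>L blinfun_inner_right b"

lemma rank_one_apply: "blinfun_apply (rank_one a b) h = (b \<bullet> h) *\<^sub>R a"
  by (simp add: rank_one_def)

definition loewner_le :: "('a::euclidean_space \<Rightarrow>\<^sub>L 'a) \<Rightarrow> ('a \<Rightarrow>\<^sub>L 'a) \<Rightarrow> bool" where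
  "loewner_le A C \<longleftrightarrow> (\<forall>x. x \<bullet> A x \<le> x \<bullet> C x)"

definition self_adjoint_pd :: "('a::euclidean_space \<Rightarrow>\<^sub>L 'a) \<Rightarrow> bool" where
  "self_adjoint_pd A \<longleftrightarrow>
    adjoint (blinfun_apply A) = blinfun_apply A \<and> (\<forall>x. x \<noteq> 0 \<longrightarrow> 0 < x \<bullet> A x)"

definition bfgs_H :: "'a::euclidean_space \<Rightarrow> 'a \<Rightarrow> ('a \<Rightarrow>\<^sub>L 'a) \<Rightarrow> 'a \<Rightarrow>\<^sub>L 'a" where
  "bfgs_H s y H =
    (let \<omega> = 1 / (s \<bullet> y);
         V = id_blinfun - \<omega> *\<^sub>R rank_one s y;
         Vt = id_blinfun - \<omega> *\<^sub>R rank_one y s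
     in V o\<^sub>L H o\<^sub>L Vt + \<omega> *\<^sub>R rank_one s s)"

definition bfgs_B :: "'a::euclidean_space \<Rightarrow> 'a \<Rightarrow> ('a \<Rightarrow>\<^sub>L 'a) \<Rightarrow> 'a \<Rightarrow>\<^sub>L 'a" where
  "bfgs_B s y B =
    B - (1 / (s \<bullet> B s)) *\<^sub>R (B o\<^sub>L rank_one s s o\<^sub>L B) + (1 / (s \<bullet> y)) *\<^sub>R rank_one y y"

definition sr1_H :: "'a::euclidean_space \<Rightarrow> 'a \<Rightarrow> ('a \<Rightarrow>\<^sub>L 'a) \<Rightarrow> 'a \<Rightarrow>\<^sub>L 'a" where
  "sr1_H s y H = (let u = s - H y in H + (1 / (u \<bullet> y)) *\<^sub>R rank_one u u)"

definition sr1_B :: "'a::euclidean_space \<Rightarrow> 'a \<Rightarrow> ('a \<Rightarrow>\<^sub>L 'a) \<Rightarrow> 'a \<Rightarrow>\<^sub>L 'a" where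
  "sr1_B s y B = (let v = y - B s in B + (1 / (v \<bullet> s)) *\<^sub>R rank_one v v)"

text \<open>The safeguards of the chosen update for the pair \<open>(s, y)\<close> and current operators
  \<open>(H, B)\<close>.\<close>

definition safeguard ::
    "crdrs_params \<Rightarrow> 'a::euclidean_space \<times> 'a \<Rightarrow> ('a \<Rightarrow>\<^sub>L 'a) \<times> ('a \<Rightarrow>\<^sub>L 'a) \<Rightarrow> bool" where
  "safeguard P = (\<lambda>(s, y) (H, B). case upd P of
      BFGS \<Rightarrow> 0 < s \<bullet> y
    | SR1 \<Rightarrow>
        (let u = s - blinfun_apply H y; v = y - blinfun_apply B s in
          u \<bullet> y \<noteq> 0 \<and> v \<bullet> s \<noteq> 0 \<and>
          \<bar>u \<bullet> y\<bar> \<ge> eps_sr1 P * norm u * norm y \<and>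
          loewner_le (h_lo P *\<^sub>R id_blinfun) (sr1_H s y H) \<and>
          loewner_le (sr1_H s y H) (h_hi P *\<^sub>R id_blinfun) \<and>
          loewner_le (inverse (h_hi P) *\<^sub>R id_blinfun) (sr1_B s y B) \<and>
          loewner_le (sr1_B s y B) (inverse (h_lo P) *\<^sub>R id_blinfun)))"

text \<open>BFGS updates are never skipped here: every pair in memory has positive curvature.\<close>

definition qn_update ::
    "crdrs_params \<Rightarrow> 'a::euclidean_space \<times> 'a \<Rightarrow>
      ('a \<Rightarrow>\<^sub>L 'a) \<times> ('a \<Rightarrow>\<^sub>L 'a) \<Rightarrow> ('a \<Rightarrow>\<^sub>L 'a) \<times> ('a \<Rightarrow>\<^sub>L 'a)" where
  "qn_update P = (\<lambda>(s, y) (H, B). case upd P of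
      BFGS \<Rightarrow> (bfgs_H s y H, bfgs_B s y B)
    | SR1 \<Rightarrow>
        if safeguard P (s, y) (H, B) then (sr1_H s y H, sr1_B s y B) else (H, B))"

text \<open>Memories are lists of pairs \<open>(s, q)\<close>, oldest first.\<close>

definition vth :: "crdrs_params \<Rightarrow> ('a::euclidean_space \<times> 'a) list \<Rightarrow> real" where
  "vth P mem =
    (if mem = [] then vth_0 P
     else case last mem of (s, q) \<Rightarrow>
       min (h_hi P) (max (h_lo P) ((s \<bullet> q) / (norm q)\<^sup>2)))"

definition qn_build ::
    "crdrs_params \<Rightarrow> ('a::euclidean_space \<times> 'a) list \<Rightarrow> ('a \<Rightarrow>\<^sub>L 'a) \<times> ('a \<Rightarrow>\<^sub>L 'a)" where
  "qn_build P mem =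
    fold (qn_update P) mem (vth P mem *\<^sub>R id_blinfun, inverse (vth P mem) *\<^sub>R id_blinfun)"

subsection \<open>One iteration\<close>

text \<open>Pseudo-states are pairs (pseudo-iterate, pseudo-residual). A zero step leaves the
  pseudo-state unchanged, and hence also all later ones.\<close>

definition pseudo_step ::
    "crdrs_params \<Rightarrow> ('a::euclidean_space \<Rightarrow>\<^sub>L 'a) \<times> ('a \<Rightarrow>\<^sub>L 'a) \<Rightarrow> 'a \<times> 'a \<Rightarrow> 'a \<times> 'a" where
  "pseudo_step P = (\<lambda>(H, B) (xt, rt).
    let d = - blinfun_apply H rt;
        \<eta> = (if d \<noteq> 0 \<and> rt \<bullet> d < 0 \<and> 0 < d \<bullet> blinfun_apply B d
             then min (eta_bar P) (nu_qn P * (- (rt \<bullet> d) / (d \<bullet> blinfun_apply B d)))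
             else 0);
        xt' = xt + \<eta> *\<^sub>R d
    in (xt', rt + blinfun_apply B (xt' - xt)))"

text \<open>In the following, \<open>zk\<close> is the center \<open>z\<^sub>k\<close> and \<open>a\<close> the anchor with index \<open>k - 1\<close>.\<close>

definition candidate ::
    "crdrs_params \<Rightarrow> ('a::euclidean_space \<Rightarrow> real) \<Rightarrow> ('a \<times> 'a) list \<Rightarrow> 'a \<Rightarrow> 'a \<Rightarrow> 'a" where
  "candidate P f mem zk a =
    fst ((pseudo_step P (qn_build P mem) ^^ pred_steps P) (a, res P f zk a))"

definition accepts ::
    "crdrs_params \<Rightarrow> ('a::euclidean_space \<Rightarrow> real) \<Rightarrow> 'a \<Rightarrow> 'a \<Rightarrow> 'a \<Rightarrow> bool" where
  "accepts P f zk a xh \<longleftrightarrow>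
    res P f zk a \<bullet> (xh - a) < 0 \<and>
    phi P f zk xh \<le> phi P f zk a + armijo P * (res P f zk a \<bullet> (xh - a)) \<and>
    norm (res P f zk xh) \<le> m_const P / L_const P * theta_Q P * norm (res P f zk a)"

definition fallback :: "crdrs_params \<Rightarrow> ('a::euclidean_space \<Rightarrow> real) \<Rightarrow> 'a \<Rightarrow> 'a \<Rightarrow> 'a" where
  "fallback P f zk a =
    ((\<lambda>u. u - (2 / (m_const P + L_const P)) *\<^sub>R res P f zk u) ^^ fb_steps P) a"

definition corrected_point ::
    "crdrs_params \<Rightarrow> ('a::euclidean_space \<Rightarrow> real) \<Rightarrow> ('a \<times> 'a) list \<Rightarrow> 'a \<Rightarrow> 'a \<Rightarrow> 'a" where
  "corrected_point P f mem zk a =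
    (let xh = candidate P f mem zk a
     in if accepts P f zk a xh then xh else fallback P f zk a)"

definition curvature_ok :: "crdrs_params \<Rightarrow> 'a::euclidean_space \<times> 'a \<Rightarrow> bool" where
  "curvature_ok P = (\<lambda>(s, q). s \<bullet> q \<ge> eps_curv P * norm s * norm q)"

definition mem_append ::
    "crdrs_params \<Rightarrow> ('a \<times> 'a) list \<Rightarrow> 'a \<times> 'a \<Rightarrow> ('a \<times> 'a) list" where
  "mem_append P mem p =
    (let mem' = mem @ [p] in if enat (length mem') \<le> mem_cap P then mem' else tl mem')"

text \<open>A pair may be appended only if the tests hold. It is not required that every pair
  passing the tests is appended, so the rule that appends exactly those pairs is included.\<close>

definition mem_step ::
    "crdrs_params \<Rightarrow> ('a::euclidean_space \<times> 'a) list \<Rightarrow> 'a \<times> 'a \<Rightarrow> ('a \<times> 'a) list \<Rightarrow> bool" where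
  "mem_step P mem p mem' \<longleftrightarrow>
    mem' = mem \<or>
    curvature_ok P p \<and> safeguard P p (qn_build P mem) \<and> mem' = mem_append P mem p"

subsection \<open>Initial memory and runs\<close>

definition exact_secant_pair ::
    "crdrs_params \<Rightarrow> ('a::euclidean_space \<Rightarrow> real) \<Rightarrow> 'a \<times> 'a \<Rightarrow> bool" where
  "exact_secant_pair P f = (\<lambda>(s, q).
    \<exists>u v. s = v - u \<and> q = gam P *\<^sub>R (grad f v - grad f u) + s)"

text \<open>The SR1 safeguards depend on the operators in use when the pair was accepted. For a
  pair of the initial memory these may be any admissible operators.\<close>

definition accepted_pair :: "crdrs_params \<Rightarrow> 'a::euclidean_space \<times> 'a \<Rightarrow> bool" where
  "accepted_pair P p \<longleftrightarrow> curvature_ok P p \<and>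
    (\<exists>H B. self_adjoint_pd H \<and> self_adjoint_pd B \<and>
      H o\<^sub>L B = id_blinfun \<and> B o\<^sub>L H = id_blinfun \<and> safeguard P p (H, B))"

definition initial_memory ::
    "crdrs_params \<Rightarrow> ('a::euclidean_space \<Rightarrow> real) \<Rightarrow> ('a \<times> 'a) list \<Rightarrow> bool" where
  "initial_memory P f mem \<longleftrightarrow>
    enat (length mem) \<le> mem_cap P \<and>
    (\<forall>p \<in> set mem. exact_secant_pair P f p \<and> accepted_pair P p)"

text \<open>Anchors are shifted by one: \<open>a 0\<close> is the input with index \<open>-1\<close>, and \<open>a (Suc k)\<close> is the
  anchor with index \<open>k\<close>. The inputs \<open>z 0\<close> and \<open>a 0\<close> are arbitrary.\<close>

definition crdrs_run ::
    "crdrs_params \<Rightarrow> ('a::euclidean_space \<Rightarrow> real) \<Rightarrow> ('a \<Rightarrow> ereal) \<Rightarrow>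
      (nat \<Rightarrow> 'a) \<Rightarrow> (nat \<Rightarrow> 'a) \<Rightarrow> (nat \<Rightarrow> 'a) \<Rightarrow> (nat \<Rightarrow> ('a \<times> 'a) list) \<Rightarrow> bool" where
  "crdrs_run P f g z a x mem \<longleftrightarrow>
    initial_memory P f (mem 0) \<and>
    (\<forall>k.
      x k = corrected_point P f (mem k) (z k) (a k) \<and>
      mem_step P (mem k)
        (x k - a k, res P f (z k) (x k) - res P f (z k) (a k)) (mem (Suc k)) \<and>
      z (Suc k) =
        z k + (2 * relax P) *\<^sub>R (prox (gam P) g (2 *\<^sub>R x k - z k) - x k) \<and>
      a (Suc k) = x k)"

end

theory Submission
  imports Defs
begin

text \<open>
  Cocoercivity of \<open>\<nabla>f - \<sigma> I\<close> says that \<open>(d, q) = (x - y, \<nabla>f x - \<nabla>f y)\<close> satisfies the sector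
  condition \<open>\<langle>q - \<sigma> d, \<beta> d - q\<rangle> \<ge> 0\<close>, i.e. \<open>q\<close> lies in a ball with diameter from \<open>\<sigma> d\<close> to \<open>\<beta> d\<close>.
  Linear changes of \<open>(d, q)\<close> turn this single fact into the two-sided residual bounds (hence
  the factor \<open>\<theta>\<^sub>Q\<close> of accepted candidates), the rate \<open>\<theta>\<^sub>G\<close> of the fallback gradient step, the
  \<open>1/m\<close>-Lipschitz continuity of \<open>P\<^bsub>\<gamma>f\<^esub>\<close>, and the contraction factor \<open>\<delta>\<close> of \<open>R\<^bsub>\<gamma>f\<^esub>\<close>. As \<open>R\<^bsub>\<gamma>g\<^esub>\<close> is
  nonexpansive, \<open>T\<close> is a \<open>\<rho>\<close>-contraction, and an error \<open>E\<^sub>k\<close> in the first proximal point perturbs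
  a DRS step by at most \<open>2 \<alpha> E\<^sub>k\<close>; a warm start at \<open>x\<^sub>k\<close> costs in addition \<open>\<parallel>z\<^bsub>k+1\<^esub> - z\<^sub>k\<parallel> / m\<close>.
\<close>

section \<open>Proximal points of extended-valued convex functions\<close>

text \<open>The optimality condition \<open>u - x \<in> \<gamma> \<partial>h(x)\<close>, written with real upper bounds \<open>s\<close> of \<open>h y\<close>
  so that no arithmetic on \<^typ>\<open>ereal\<close> occurs.\<close>

definition is_prox :: "real \<Rightarrow> ('a::real_inner \<Rightarrow> ereal) \<Rightarrow> 'a \<Rightarrow> 'a \<Rightarrow> bool" where
  "is_prox \<gamma> h u x \<longleftrightarrow> (\<exists>r. h x = ereal r \<and>
    (\<forall>y s. h y \<le> ereal s \<longrightarrow> \<gamma> * r + (u - x) \<bullet> (y - x) \<le> \<gamma> * s))"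

text \<open>Expanding \<open>(norm (y - u))\<^sup>2\<close> around \<open>x\<close> turns the
  variational inequality into a gap of at least half the squared distance from \<open>x\<close> to
  \<open>y\<close>. Hence \<open>x\<close> is the only minimizer, and the choice operator in
  \<open>prox\<close> must return it.\<close>

lemma is_prox_imp_prox:
  fixes h :: "'a::real_inner \<Rightarrow> ereal"
  assumes "0 < \<gamma>" and "is_prox \<gamma> h u x"
  shows "prox \<gamma> h u = x"
proof -
  define F where "F = (\<lambda>y. ereal \<gamma> * h y + ereal ((norm (y - u))\<^sup>2 / 2))"
  obtain r where r: "h x = ereal r"
    and var: "\<And>y s. h y \<le> ereal s \<Longrightarrow> \<gamma> * r + (u - x) \<bullet> (y - x) \<le> \<gamma> * s"
    using assms(2) unfolding is_prox_def by blast
  have less: "F x < F y" if "y \<noteq> x" for y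
  proof (cases "h y")
    case (real s)
    have "\<gamma> * r + (u - x) \<bullet> (y - x) \<le> \<gamma> * s"
      by (rule var) (simp add: real)
    moreover have "(norm (y - u))\<^sup>2 = (norm (x - u))\<^sup>2 + (norm (y - x))\<^sup>2 - 2 * ((u - x) \<bullet> (y - x))"
      by (simp add: power2_norm_eq_inner algebra_simps inner_commute)
    moreover have "0 < (norm (y - x))\<^sup>2"
      using that by simp
    ultimately have "\<gamma> * r + (norm (x - u))\<^sup>2 / 2 < \<gamma> * s + (norm (y - u))\<^sup>2 / 2"
      by linarith
    then show ?thesis by (simp add: F_def r real)
  next
    case PInf
    then show ?thesis using assms(1) by (simp add: F_def r)
  next
    case MInf
    \<comment> \<open>With \<open>h y\<close> equal to minus infinity every real is an upper bound;
      this one makes the right side smaller than the left by exactly 1, a contradiction.\<close>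
    have "\<gamma> * r + (u - x) \<bullet> (y - x) \<le> \<gamma> * ((\<gamma> * r + (u - x) \<bullet> (y - x) - 1) / \<gamma>)"
      by (rule var) (simp add: MInf)
    then show ?thesis using assms(1) by simp
  qed
  then have "is_arg_min F (\<lambda>_. True) = (\<lambda>y. y = x)"
    unfolding is_arg_min_def fun_eq_iff by (metis less_asym less_irrefl)
  then show ?thesis
    unfolding prox_def arg_min_def F_def[symmetric] by simp
qed

text \<open>Monotonicity of the subdifferential: testing each optimality condition at the other
  point and adding cancels both function values.\<close>

lemma is_prox_firmly_nonexpansive:
  assumes "is_prox \<gamma> h u x" and "is_prox \<gamma> h v y"
  shows "(norm (x - y))\<^sup>2 \<le> (u - v) \<bullet> (x - y)"
proof -
  obtain r where r: "h x = ereal r"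
    and var_x: "\<And>y s. h y \<le> ereal s \<Longrightarrow> \<gamma> * r + (u - x) \<bullet> (y - x) \<le> \<gamma> * s"
    using assms(1) unfolding is_prox_def by blast
  obtain s where s: "h y = ereal s"
    and var_y: "\<And>x r. h x \<le> ereal r \<Longrightarrow> \<gamma> * s + (v - y) \<bullet> (x - y) \<le> \<gamma> * r"
    using assms(2) unfolding is_prox_def by blast
  have "(u - x) \<bullet> (y - x) + (v - y) \<bullet> (x - y) \<le> 0"
    using var_x[of y s] var_y[of x r] by (simp add: r s)
  then show ?thesis
    by (simp add: power2_norm_eq_inner algebra_simps inner_commute)
qed

lemma reflection_nonexpansive:
  assumes "is_prox \<gamma> h u x" and "is_prox \<gamma> h v y"
  shows "norm ((2 *\<^sub>R x - u) - (2 *\<^sub>R y - v)) \<le> norm (u - v)"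
proof -
  have "(norm ((2 *\<^sub>R x - u) - (2 *\<^sub>R y - v)))\<^sup>2
      = (norm (u - v))\<^sup>2 - 4 * ((u - v) \<bullet> (x - y) - (norm (x - y))\<^sup>2)"
    by (simp add: power2_norm_eq_inner algebra_simps inner_commute)
  also have "\<dots> \<le> (norm (u - v))\<^sup>2"
    using is_prox_firmly_nonexpansive[OF assms] by simp
  finally show ?thesis by (rule power2_le_imp_le) simp
qed

section \<open>Existence of proximal points\<close>

text \<open>A point just below the graph is strictly separated from the closed convex epigraph. The
  separating hyperplane is not vertical, so it is the graph of an affine function.\<close>

lemma proper_closed_convex_affine_minorant:
  fixes g :: "'a::euclidean_space \<Rightarrow> ereal"
  assumes "proper_closed_convex g"
  shows "\<exists>p b. \<forall>x r. g x \<le> ereal r \<longrightarrow> b + p \<bullet> x \<le> r"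
proof -
  obtain x0 where x0: "g x0 \<noteq> \<infinity>" "g x0 \<noteq> -\<infinity>"
    using assms unfolding proper_closed_convex_def by blast
  then obtain r0 where r0: "g x0 = ereal r0" by (cases "g x0") auto
  have "(x0, r0 - 1) \<notin> ext_epigraph g"
    by (simp add: ext_epigraph_def r0)
  then obtain a b where sep: "a \<bullet> (x0, r0 - 1) < b" "\<And>w. w \<in> ext_epigraph g \<Longrightarrow> b < a \<bullet> w"
    using separating_hyperplane_closed_point[of "ext_epigraph g" "(x0, r0 - 1)"] assms
    unfolding proper_closed_convex_def by blast
  obtain p s where a: "a = (p, s)" by (cases a)
  \<comment> \<open>Heights \<open>r0 - 1\<close> and \<open>r0\<close> over the same point
    \<open>x0\<close> lie on opposite sides, which forces the vertical component \<open>s\<close> to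
    be positive.\<close>
  have "b < a \<bullet> (x0, r0)"
    by (rule sep(2)) (simp add: ext_epigraph_def r0)
  then have "0 < s"
    using sep(1) by (simp add: a algebra_simps)
  have "b / s + (- (1 / s) *\<^sub>R p) \<bullet> x \<le> r" if "g x \<le> ereal r" for x r
  proof -
    have "b < p \<bullet> x + s * r"
      using sep(2)[of "(x, r)"] that by (simp add: ext_epigraph_def a)
    then show ?thesis
      using \<open>0 < s\<close> by (simp add: field_simps)
  qed
  then show ?thesis by blast
qed

text \<open>Minimizing over pairs (point, height) in the epigraph replaces the extended-valued
  objective by a continuous real one. The affine minorant bounds its sublevel set, so compactness
  yields a minimizer.\<close>

lemma ex_minimizer_prox_objective:
  fixes g :: "'a::euclidean_space \<Rightarrow> ereal"
  assumes g: "proper_closed_convex g" and "0 < \<gamma>"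
  shows "\<exists>x r. g x = ereal r \<and> (\<forall>y s. g y \<le> ereal s \<longrightarrow>
      \<gamma> * r + (norm (x - u))\<^sup>2 / 2 \<le> \<gamma> * s + (norm (y - u))\<^sup>2 / 2)"
proof -
  obtain p b where minor: "\<And>x r. g x \<le> ereal r \<Longrightarrow> b + p \<bullet> x \<le> r"
    using proper_closed_convex_affine_minorant[OF g] by blast
  obtain x0 where x0: "g x0 \<noteq> \<infinity>" "g x0 \<noteq> -\<infinity>"
    using g unfolding proper_closed_convex_def by blast
  then obtain r0 where r0: "g x0 = ereal r0" by (cases "g x0") auto
  define F where "F = (\<lambda>w :: 'a \<times> real. \<gamma> * snd w + (norm (fst w - u))\<^sup>2 / 2)"
  define S where "S = ext_epigraph g \<inter> {w. F w \<le> F (x0, r0)}"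
  have contF: "continuous_on UNIV F"
    unfolding F_def by (intro continuous_intros) auto
  have "closed S"
    unfolding S_def
    using g closed_Collect_le[OF contF continuous_on_const[of UNIV "F (x0, r0)"]]
    by (simp add: proper_closed_convex_def closed_Int)
  \<comment> \<open>Replacing the height by the minorant \<open>b + p \<bullet> y\<close> and
    completing the square gives the centre \<open>v\<close> and the radius \<open>R\<close> of a
    ball containing all points of the sublevel set.\<close>
  define v where "v = u - \<gamma> *\<^sub>R p"
  define R where "R = sqrt (2 * (F (x0, r0) - \<gamma> * b - \<gamma> * (p \<bullet> u)) + (\<gamma> * norm p)\<^sup>2)"
  have in_S: "w \<in> cball v R \<times> {b - norm p * (norm v + R) .. F (x0, r0) / \<gamma>}" if "w \<in> S" for w
  proof -
    obtain y s where w: "w = (y, s)" by (cases w)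
    have ys: "b + p \<bullet> y \<le> s" and F: "\<gamma> * s + (norm (y - u))\<^sup>2 / 2 \<le> F (x0, r0)"
      using that by (auto simp: S_def w ext_epigraph_def F_def intro: minor)
    have "\<gamma> * (b + p \<bullet> y) \<le> \<gamma> * s" using ys \<open>0 < \<gamma>\<close> by simp
    moreover have "(norm (v - y))\<^sup>2
        = (norm (y - u))\<^sup>2 + 2 * \<gamma> * (p \<bullet> y) - 2 * \<gamma> * (p \<bullet> u) + (\<gamma> * norm p)\<^sup>2"
      unfolding v_def power_mult_distrib power2_norm_eq_inner
      by (simp add: algebra_simps inner_commute power2_eq_square)
    ultimately have "(norm (v - y))\<^sup>2
        \<le> 2 * (F (x0, r0) - \<gamma> * b - \<gamma> * (p \<bullet> u)) + (\<gamma> * norm p)\<^sup>2"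
      using F by (simp add: algebra_simps)
    then have vy: "norm (v - y) \<le> R"
      unfolding R_def by (rule real_le_rsqrt)
    have "norm y \<le> norm v + norm (v - y)"
      using norm_triangle_ineq4[of v "v - y"] by simp
    then have "norm p * norm y \<le> norm p * (norm v + R)"
      using vy by (intro mult_left_mono) auto
    then have "b - norm p * (norm v + R) \<le> s"
      using ys Cauchy_Schwarz_ineq2[of p y] by linarith
    moreover have "s * \<gamma> \<le> F (x0, r0)"
      using F zero_le_power2[of "norm (y - u)"] by argo
    then have "s \<le> F (x0, r0) / \<gamma>"
      using \<open>0 < \<gamma>\<close> by (simp add: pos_le_divide_eq)
    ultimately show ?thesis
      using vy by (simp add: w dist_norm)
  qed
  have "bounded S"
    by (rule bounded_subset[OF bounded_Times[OF bounded_cball bounded_closed_interval]])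
      (use in_S in blast)
  with \<open>closed S\<close> have "compact S" by (simp add: compact_eq_bounded_closed)
  moreover have "(x0, r0) \<in> S"
    by (simp add: S_def ext_epigraph_def r0)
  ultimately obtain w where w: "w \<in> S" "\<And>w'. w' \<in> S \<Longrightarrow> F w \<le> F w'"
    using continuous_attains_inf[of S F] continuous_on_subset[OF contF] by blast
  obtain x r where xr: "w = (x, r)" by (cases w)
  have min: "F (x, r) \<le> F (y, s)" if "g y \<le> ereal s" for y s
    using w that by (cases "F (y, s) \<le> F (x0, r0)") (auto simp: S_def ext_epigraph_def xr)
  have "g x \<le> ereal r" using w(1) by (simp add: S_def ext_epigraph_def xr)
  moreover have "g x \<noteq> -\<infinity>" using g by (simp add: proper_closed_convex_def)
  ultimately obtain t where t: "g x = ereal t" "t \<le> r" by (cases "g x") auto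
  \<comment> \<open>Lowering the height to the value \<open>t\<close> of \<open>g x\<close> stays in
    the epigraph, so a minimizing pair lies on the graph.\<close>
  have "\<gamma> * r \<le> \<gamma> * t"
    using min[of x t] t by (simp add: F_def)
  then have "t = r" using t \<open>0 < \<gamma>\<close> by simp
  then have "g x = ereal r" using t by simp
  moreover have "\<gamma> * r + (norm (x - u))\<^sup>2 / 2 \<le> \<gamma> * s + (norm (y - u))\<^sup>2 / 2"
    if "g y \<le> ereal s" for y s
    using min[OF that] by (simp add: F_def)
  ultimately show ?thesis by blast
qed

text \<open>Divide by \<open>t\<close> and let \<open>t\<close> tend to 0 from the right.\<close>

lemma nonneg_if_quadratic_nonneg:
  fixes a c :: real
  assumes "\<And>t. 0 < t \<Longrightarrow> t \<le> 1 \<Longrightarrow> 0 \<le> t * a + t\<^sup>2 * c"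
  shows "0 \<le> a"
proof -
  have "((\<lambda>t. a + t * c) \<longlongrightarrow> a + 0 * c) (at_right 0)"
    by (intro tendsto_intros)
  moreover have "eventually (\<lambda>t. 0 \<le> a + t * c) (at_right 0)"
  proof (rule eventually_at_rightI[of 0 1])
    fix t :: real assume "t \<in> {0<..<1}"
    then have "0 \<le> t * (a + t * c)" "0 < t"
      using assms[of t] by (auto simp: algebra_simps power2_eq_square)
    then show "0 \<le> a + t * c" by (simp add: zero_le_mult_iff)
  qed simp
  ultimately show ?thesis
    using tendsto_lowerbound[of "\<lambda>t. a + t * c" "a + 0 * c" "at_right 0" 0] by simp
qed

text \<open>Moving the minimizer towards \<open>y\<close> by a fraction \<open>t\<close> changes the
  upper bound on the objective by a quadratic in \<open>t\<close>. Minimality makes it nonnegative,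
  so its linear coefficient, which is the variational inequality, is nonnegative.\<close>

lemma ex_is_prox:
  fixes g :: "'a::euclidean_space \<Rightarrow> ereal"
  assumes g: "proper_closed_convex g" and "0 < \<gamma>"
  shows "\<exists>x. is_prox \<gamma> g u x"
proof -
  obtain x r where r: "g x = ereal r" and min: "\<And>y s. g y \<le> ereal s \<Longrightarrow>
      \<gamma> * r + (norm (x - u))\<^sup>2 / 2 \<le> \<gamma> * s + (norm (y - u))\<^sup>2 / 2"
    using ex_minimizer_prox_objective[OF assms] by blast
  have "\<gamma> * r + (u - x) \<bullet> (y - x) \<le> \<gamma> * s" if ys: "g y \<le> ereal s" for y s
  proof -
    have "0 \<le> t * (\<gamma> * (s - r) - (u - x) \<bullet> (y - x)) + t\<^sup>2 * ((norm (y - x))\<^sup>2 / 2)"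
      if t: "0 < t" "t \<le> 1" for t
    proof -
      have "(1 - t) *\<^sub>R (x, r) + t *\<^sub>R (y, s) \<in> ext_epigraph g"
        using g t ys unfolding proper_closed_convex_def convex_def
        by (auto simp: ext_epigraph_def r)
      then have "g ((1 - t) *\<^sub>R x + t *\<^sub>R y) \<le> ereal ((1 - t) * r + t * s)"
        by (simp add: ext_epigraph_def)
      note min[OF this]
      moreover have "(norm ((1 - t) *\<^sub>R x + t *\<^sub>R y - u))\<^sup>2
          = (norm (x - u))\<^sup>2 - 2 * t * ((u - x) \<bullet> (y - x)) + t\<^sup>2 * (norm (y - x))\<^sup>2"
        unfolding power2_norm_eq_inner
        by (simp add: algebra_simps inner_commute power2_eq_square)
      ultimately show ?thesis by (simp add: algebra_simps)
    qed
    from nonneg_if_quadratic_nonneg[OF this] show ?thesis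
      by (simp add: algebra_simps)
  qed
  then show ?thesis using r unfolding is_prox_def by blast
qed

lemma is_prox_prox:
  fixes g :: "'a::euclidean_space \<Rightarrow> ereal"
  assumes "proper_closed_convex g" and "0 < \<gamma>"
  shows "is_prox \<gamma> g u (prox \<gamma> g u)"
  using ex_is_prox[OF assms] is_prox_imp_prox[OF assms(2)] by metis

lemma refl_prox_nonexpansive:
  fixes g :: "'a::euclidean_space \<Rightarrow> ereal"
  assumes "proper_closed_convex g" and "0 < \<gamma>"
  shows "norm (refl_prox \<gamma> g u - refl_prox \<gamma> g v) \<le> norm (u - v)"
  unfolding refl_prox_def by (rule reflection_nonexpansive) (rule is_prox_prox[OF assms])+

section \<open>Smooth strongly convex functions\<close>

text \<open>The Riesz representative of the derivative is assembled from an orthonormal basis; its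
  uniqueness justifies the definite description in \<open>grad\<close>.\<close>

lemma GDERIV_grad:
  fixes f :: "'a::euclidean_space \<Rightarrow> real"
  assumes "f differentiable at x"
  shows "GDERIV f x :> grad f x"
proof -
  obtain D where D: "(f has_derivative D) (at x)"
    using assms unfolding differentiable_def by blast
  interpret bounded_linear D using D by (rule has_derivative_bounded_linear)
  define d where "d = (\<Sum>i\<in>Basis. D i *\<^sub>R i)"
  have "D h = h \<bullet> d" for h
  proof -
    have "D h = D (\<Sum>i\<in>Basis. (h \<bullet> i) *\<^sub>R i)" by (simp add: euclidean_representation)
    also have "\<dots> = h \<bullet> d" by (simp add: sum scaleR d_def inner_sum_right mult.commute)
    finally show ?thesis .
  qed
  then have "D = (\<lambda>h. h \<bullet> d)" by (rule ext)
  then have "GDERIV f x :> d" using D by (simp add: gderiv_def)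
  moreover have "e = d" if "GDERIV f x :> e" for e
  proof -
    have "(\<lambda>h. h \<bullet> e) = (\<lambda>h. h \<bullet> d)"
      using that \<open>GDERIV f x :> d\<close> unfolding gderiv_def by (rule has_derivative_unique)
    then have "\<And>h. h \<bullet> e = h \<bullet> d" by (rule fun_cong)
    then show ?thesis by (metis inner_commute vector_eq_rdot)
  qed
  ultimately show ?thesis unfolding grad_def by (rule theI)
qed

lemma GDERIV_along_line:
  fixes f :: "'a::euclidean_space \<Rightarrow> real"
  assumes "GDERIV f (x + t *\<^sub>R d) :> D"
  shows "((\<lambda>t. f (x + t *\<^sub>R d)) has_real_derivative d \<bullet> D) (at t)"
proof -
  have "((\<lambda>t. x + t *\<^sub>R d) has_derivative (\<lambda>h. h *\<^sub>R d)) (at t)"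
    by (auto intro!: derivative_eq_intros)
  from has_derivative_compose[OF this assms[unfolded gderiv_def]]
  have "((\<lambda>t. f (x + t *\<^sub>R d)) has_derivative (\<lambda>h. (h *\<^sub>R d) \<bullet> D)) (at t)" .
  moreover have "(\<lambda>h. (h *\<^sub>R d) \<bullet> D) = (*) (d \<bullet> D)"
    by (simp add: fun_eq_iff)
  ultimately show ?thesis by (simp add: has_field_derivative_def)
qed

text \<open>Along the segment, \<open>f\<close> minus its quadratic upper model has nonpositive
  derivative by Cauchy-Schwarz and the Lipschitz bound, hence does not increase from 0 to 1.\<close>

lemma descent_lemma:
  fixes f :: "'a::euclidean_space \<Rightarrow> real"
  assumes grad: "\<And>x. GDERIV f x :> f' x" and lip: "\<beta>-lipschitz_on UNIV f'"
  shows "f y \<le> f x + f' x \<bullet> (y - x) + \<beta> / 2 * (norm (y - x))\<^sup>2"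
proof -
  define d where "d = y - x"
  define \<psi> where "\<psi> = (\<lambda>t. f (x + t *\<^sub>R d) - t * (f' x \<bullet> d) - \<beta> * t\<^sup>2 / 2 * (norm d)\<^sup>2)"
  have "\<psi> 1 \<le> \<psi> 0"
  proof (rule DERIV_nonpos_imp_nonincreasing[of 0 1])
    fix t :: real assume t: "0 \<le> t" "t \<le> 1"
    have "(\<psi> has_real_derivative
        d \<bullet> f' (x + t *\<^sub>R d) - f' x \<bullet> d - \<beta> * t * (norm d)\<^sup>2) (at t)"
      unfolding \<psi>_def
      by (auto intro!: derivative_eq_intros GDERIV_along_line[OF grad])
    moreover have "d \<bullet> f' (x + t *\<^sub>R d) - f' x \<bullet> d \<le> \<beta> * t * (norm d)\<^sup>2"
    proof -
      have "d \<bullet> (f' (x + t *\<^sub>R d) - f' x) \<le> norm d * norm (f' (x + t *\<^sub>R d) - f' x)"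
        by (rule norm_cauchy_schwarz)
      also have "\<dots> \<le> norm d * (\<beta> * norm (t *\<^sub>R d))"
        using lipschitz_onD[OF lip, of "x + t *\<^sub>R d" x]
        by (intro mult_left_mono) (auto simp: dist_norm)
      finally show ?thesis
        using t by (simp add: inner_diff_right inner_commute power2_eq_square algebra_simps)
    qed
    ultimately show "\<exists>D. DERIV \<psi> t :> D \<and> D \<le> 0" by force
  qed simp
  then show ?thesis by (simp add: \<psi>_def d_def)
qed

text \<open>Strong convexity bounds the difference quotients along the segment from \<open>x\<close>
  to \<open>y\<close>; the limit at 0 from the right replaces them by the directional
  derivative.\<close>

lemma strongly_convex_gradient_inequality:
  fixes f :: "'a::euclidean_space \<Rightarrow> real"
  assumes grad: "GDERIV f x :> D" and sc: "strongly_convex \<sigma> f"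
  shows "f x + D \<bullet> (y - x) + \<sigma> / 2 * (norm (y - x))\<^sup>2 \<le> f y"
proof -
  define d where "d = y - x"
  have "((\<lambda>t. f (x + t *\<^sub>R d)) has_real_derivative d \<bullet> D) (at 0)"
    by (rule GDERIV_along_line) (simp add: grad)
  then have "((\<lambda>t. (f (x + t *\<^sub>R d) - f x) / t) \<longlongrightarrow> d \<bullet> D) (at_right 0)"
    unfolding has_field_derivative_iff by (auto intro: filterlim_mono simp: at_le)
  moreover have "((\<lambda>t. f y - f x - \<sigma> / 2 * (1 - t) * (norm d)\<^sup>2) \<longlongrightarrow>
      f y - f x - \<sigma> / 2 * (1 - 0) * (norm d)\<^sup>2) (at_right 0)"
    by (intro tendsto_intros)
  moreover have "eventually (\<lambda>t. (f (x + t *\<^sub>R d) - f x) / t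
      \<le> f y - f x - \<sigma> / 2 * (1 - t) * (norm d)\<^sup>2) (at_right 0)"
  proof (rule eventually_at_rightI[of 0 1])
    fix t :: real assume t: "t \<in> {0<..<1}"
    have "t *\<^sub>R y + (1 - t) *\<^sub>R x = x + t *\<^sub>R d"
      by (simp add: d_def algebra_simps)
    then have "f (x + t *\<^sub>R d)
        \<le> t * f y + (1 - t) * f x - \<sigma> / 2 * t * (1 - t) * (norm d)\<^sup>2"
      using sc t unfolding strongly_convex_def d_def
      by (metis greaterThanLessThan_iff less_imp_le)
    then have "f (x + t *\<^sub>R d) - f x \<le> t * (f y - f x - \<sigma> / 2 * (1 - t) * (norm d)\<^sup>2)"
      by (simp add: algebra_simps)
    then show "(f (x + t *\<^sub>R d) - f x) / t \<le> f y - f x - \<sigma> / 2 * (1 - t) * (norm d)\<^sup>2"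
      using t by (simp add: divide_le_eq mult.commute)
  qed simp
  ultimately have "d \<bullet> D \<le> f y - f x - \<sigma> / 2 * (1 - 0) * (norm d)\<^sup>2"
    by (intro tendsto_le[of "at_right (0::real)"]) auto
  then show ?thesis by (simp add: d_def inner_commute)
qed

section \<open>The sector condition and cocoercivity of the gradient\<close>

text \<open>Thales' theorem as an identity: the squared distance from \<open>q\<close> to the
  midpoint of \<open>s *\<^sub>R d\<close> and \<open>l *\<^sub>R d\<close> is the squared radius
  minus the sector product.\<close>

lemma sector_imp_ball:
  fixes q d :: "'a::real_inner"
  assumes sector: "0 \<le> (q - s *\<^sub>R d) \<bullet> (l *\<^sub>R d - q)" and "s \<le> l"
  shows "norm (q - ((s + l) / 2) *\<^sub>R d) \<le> (l - s) / 2 * norm d"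
proof (rule power2_le_imp_le)
  have "(norm (q - ((s + l) / 2) *\<^sub>R d))\<^sup>2
      = ((l - s) / 2)\<^sup>2 * (d \<bullet> d) - (q - s *\<^sub>R d) \<bullet> (l *\<^sub>R d - q)"
    unfolding power2_norm_eq_inner
    by (simp add: inner_simps inner_commute power2_eq_square) (simp add: field_simps)
  also have "\<dots> \<le> ((l - s) / 2)\<^sup>2 * (d \<bullet> d)"
    using sector by simp
  also have "\<dots> = ((l - s) / 2 * norm d)\<^sup>2"
    unfolding power_mult_distrib power2_norm_eq_inner ..
  finally show "(norm (q - ((s + l) / 2) *\<^sub>R d))\<^sup>2 \<le> ((l - s) / 2 * norm d)\<^sup>2" .
qed (use assms in simp)

text \<open>For nonnegative \<open>s\<close> the ball lies between the spheres of radius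
  \<open>s * norm d\<close> and \<open>l * norm d\<close> around the origin.\<close>

lemma sector_norm_bounds:
  fixes q d :: "'a::real_inner"
  assumes "0 \<le> (q - s *\<^sub>R d) \<bullet> (l *\<^sub>R d - q)" and "0 \<le> s" "s \<le> l"
  shows "s * norm d \<le> norm q" "norm q \<le> l * norm d"
proof -
  have "norm (q - ((s + l) / 2) *\<^sub>R d) \<le> (l - s) / 2 * norm d"
    by (rule sector_imp_ball) (use assms in auto)
  moreover have "norm (((s + l) / 2) *\<^sub>R d) = (s + l) / 2 * norm d"
    using assms by simp
  ultimately show "s * norm d \<le> norm q" "norm q \<le> l * norm d"
    using norm_triangle_ineq2[of q "((s + l) / 2) *\<^sub>R d"]
      norm_triangle_ineq3[of q "((s + l) / 2) *\<^sub>R d"]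
    by (auto simp: algebra_simps add_divide_distrib diff_divide_distrib)
qed

locale smooth_strongly_convex =
  fixes f :: "'a::euclidean_space \<Rightarrow> real" and \<sigma> \<beta> :: real
  assumes differentiable: "\<And>x. f differentiable at x"
    and strongly_convex: "strongly_convex \<sigma> f"
    and lipschitz_grad: "\<beta>-lipschitz_on UNIV (grad f)"
    and sigma_pos: "0 < \<sigma>" and sigma_le_beta: "\<sigma> \<le> \<beta>"
begin

lemma GDERIV: "GDERIV f x :> grad f x"
  by (rule GDERIV_grad[OF differentiable])

lemmas lower_quadratic = strongly_convex_gradient_inequality[OF GDERIV strongly_convex]
lemmas upper_quadratic = descent_lemma[OF GDERIV lipschitz_grad]

text \<open>The Baillon--Haddad inequality for \<open>f - \<sigma>/2 \<parallel>\<cdot>\<parallel>\<^sup>2\<close>, with the step \<open>t\<close> left free so that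
  the degenerate case \<open>\<sigma> = \<beta>\<close> is covered as well.\<close>

lemma bregman_lower_bound:
  defines "h \<equiv> \<lambda>x. grad f x - \<sigma> *\<^sub>R x"
  shows "t * (norm (h y - h x))\<^sup>2 - (\<beta> - \<sigma>) / 2 * t\<^sup>2 * (norm (h y - h x))\<^sup>2
    \<le> f y - f x - grad f x \<bullet> (y - x) - \<sigma> / 2 * (norm (y - x))\<^sup>2"
proof -
  define d where "d = h y - h x"
  \<comment> \<open>\<open>d\<close> is the gradient at \<open>y\<close> of the Bregman remainder on
    the right of the claim, so \<open>w\<close> is a gradient step of length \<open>t\<close> on
    that remainder. The lower model at \<open>x\<close> and the upper model at \<open>y\<close> are
    compared there.\<close>
  define w where "w = y - t *\<^sub>R d"
  have gy: "grad f y = grad f x + d + \<sigma> *\<^sub>R (y - x)"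
    by (simp add: d_def h_def algebra_simps)
  have "f x + grad f x \<bullet> (w - x) + \<sigma> / 2 * (norm (w - x))\<^sup>2
      \<le> f y + grad f y \<bullet> (w - y) + \<beta> / 2 * (norm (w - y))\<^sup>2"
    using lower_quadratic[of x w] upper_quadratic[of w y] by linarith
  moreover have "grad f x \<bullet> (w - x) = grad f x \<bullet> (y - x) - t * (grad f x \<bullet> d)"
    by (simp add: w_def inner_simps)
  moreover have "(norm (w - x))\<^sup>2
      = (norm (y - x))\<^sup>2 - 2 * t * (d \<bullet> (y - x)) + t\<^sup>2 * (norm d)\<^sup>2"
    unfolding power2_norm_eq_inner w_def
    by (simp add: inner_simps inner_commute power2_eq_square algebra_simps)
  moreover have "grad f y \<bullet> (w - y)
      = - t * (grad f x \<bullet> d) - t * (norm d)\<^sup>2 - t * \<sigma> * (d \<bullet> (y - x))"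
    unfolding gy power2_norm_eq_inner w_def
    by (simp add: inner_simps inner_commute algebra_simps)
  moreover have "(norm (w - y))\<^sup>2 = t\<^sup>2 * (norm d)\<^sup>2"
    by (simp add: w_def power_mult_distrib)
  ultimately show ?thesis
    unfolding d_def[symmetric] by (simp add: algebra_simps diff_divide_distrib)
qed

text \<open>Adding the Bregman bounds for \<open>(x, y)\<close> and \<open>(y, x)\<close> cancels
  the function values and leaves an inequality valid for every step \<open>t\<close>, which is then
  optimized.\<close>

lemma grad_sector:
  "0 \<le> (grad f x - grad f y - \<sigma> *\<^sub>R (x - y)) \<bullet> (\<beta> *\<^sub>R (x - y) - (grad f x - grad f y))"
proof -
  define h where "h = (\<lambda>x. grad f x - \<sigma> *\<^sub>R x)"
  define d where "d = h x - h y"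
  define l where "l = \<beta> - \<sigma>"
  have ineq: "2 * t * (norm d)\<^sup>2 - l * t\<^sup>2 * (norm d)\<^sup>2 \<le> d \<bullet> (x - y)" for t
  proof -
    have bregman: "t * (norm (h v - h u))\<^sup>2 - l / 2 * t\<^sup>2 * (norm (h v - h u))\<^sup>2
        \<le> f v - f u - grad f u \<bullet> (v - u) - \<sigma> / 2 * (norm (v - u))\<^sup>2" for u v
      using bregman_lower_bound[of t v u] unfolding h_def l_def .
    have "d \<bullet> (x - y) = - (grad f x \<bullet> (y - x)) - grad f y \<bullet> (x - y)
        - \<sigma> * (norm (x - y))\<^sup>2"
      by (simp add: d_def h_def power2_norm_eq_inner algebra_simps inner_commute)
    moreover have "norm (h y - h x) = norm d" by (simp add: d_def norm_minus_commute)
    ultimately show ?thesis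
      using bregman[of x y] bregman[of y x]
      by (simp only: d_def[symmetric] norm_minus_commute[of y x])
  qed
  have "(norm d)\<^sup>2 \<le> l * (d \<bullet> (x - y))"
  proof (cases "l = 0")
    case True
    have "norm d = 0"
    proof (rule ccontr)
      assume "norm d \<noteq> 0"
      \<comment> \<open>For \<open>l = 0\<close> the bound is linear in \<open>t\<close>, and this
        \<open>t\<close> would make its left side exceed the right by 1.\<close>
      then have "2 * ((d \<bullet> (x - y) + 1) / (2 * (norm d)\<^sup>2)) * (norm d)\<^sup>2 = d \<bullet> (x - y) + 1"
        by simp
      with ineq[of "(d \<bullet> (x - y) + 1) / (2 * (norm d)\<^sup>2)"] True show False by simp
    qed
    then show ?thesis by (simp add: True)
  next
    case False
    then have "0 < l" using sigma_le_beta by (simp add: l_def)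
    \<comment> \<open>The value \<open>1 / l\<close> maximizes the left side over
      \<open>t\<close>.\<close>
    with ineq[of "1 / l"] show ?thesis
      by (simp add: power2_eq_square field_simps)
  qed
  moreover have "grad f x - grad f y - \<sigma> *\<^sub>R (x - y) = d"
    by (simp add: d_def h_def algebra_simps)
  moreover have "\<beta> *\<^sub>R (x - y) - (grad f x - grad f y) = l *\<^sub>R (x - y) - d"
    by (simp add: d_def h_def l_def algebra_simps)
  ultimately show ?thesis
    by (simp add: inner_diff_right power2_norm_eq_inner)
qed

end

section \<open>Residuals and the proximal map of \<open>f\<close>\<close>

locale prox_smooth = smooth_strongly_convex +
  fixes \<gamma> :: real
  assumes gamma_pos: "0 < \<gamma>"
begin

abbreviation "m \<equiv> 1 + \<gamma> * \<sigma>"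
abbreviation "L \<equiv> 1 + \<gamma> * \<beta>"
abbreviation "P_f \<equiv> prox \<gamma> (\<lambda>x. ereal (f x))"

definition resid :: "'a \<Rightarrow> 'a \<Rightarrow> 'a" where
  "resid z x = \<gamma> *\<^sub>R grad f x + x - z"

lemma m_gt_1: "1 < m" and m_le_L: "m \<le> L"
  using sigma_pos sigma_le_beta gamma_pos by auto

text \<open>Scaling the gradient by \<gamma> and adding the identity moves the sector from
  (\<sigma>, \<beta>) to (\<open>m\<close>, \<open>L\<close>); both factors are \<gamma> times those
  of \<open>grad_sector\<close>.\<close>

lemma resid_sector:
  "0 \<le> (resid z x - resid z y - m *\<^sub>R (x - y)) \<bullet> (L *\<^sub>R (x - y) - (resid z x - resid z y))"
proof -
  have "resid z x - resid z y - m *\<^sub>R (x - y) = \<gamma> *\<^sub>R (grad f x - grad f y - \<sigma> *\<^sub>R (x - y))"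
    and "L *\<^sub>R (x - y) - (resid z x - resid z y) = \<gamma> *\<^sub>R (\<beta> *\<^sub>R (x - y) - (grad f x - grad f y))"
    by (simp_all add: resid_def algebra_simps)
  then show ?thesis using grad_sector[of x y] gamma_pos by simp
qed

text \<open>The step \<open>2 / (m + L)\<close> is the reciprocal of the sector midpoint. The
  difference of two steps is therefore a multiple of the deviation from the centre of the
  ball.\<close>

lemma gradient_step_contraction:
  "norm ((x - (2 / (m + L)) *\<^sub>R resid z x) - (y - (2 / (m + L)) *\<^sub>R resid z y))
    \<le> (L - m) / (L + m) * norm (x - y)"
proof -
  define q where "q = resid z x - resid z y"
  have mL: "0 < m + L" using m_gt_1 m_le_L by linarith
  have scale: "2 / w * (r / 2 * n) = r / w * n" for w r n :: real
    by simp
  have half: "2 / (m + L) * ((m + L) / 2) = 1" using mL by simp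
  have "(x - (2 / (m + L)) *\<^sub>R resid z x) - (y - (2 / (m + L)) *\<^sub>R resid z y)
      = - ((2 / (m + L)) *\<^sub>R (q - ((m + L) / 2) *\<^sub>R (x - y)))"
    unfolding scaleR_diff_right scaleR_scaleR half q_def by (simp add: algebra_simps)
  then have "norm ((x - (2 / (m + L)) *\<^sub>R resid z x) - (y - (2 / (m + L)) *\<^sub>R resid z y))
      = 2 / (m + L) * norm (q - ((m + L) / 2) *\<^sub>R (x - y))"
    using mL by simp
  also have "\<dots> \<le> 2 / (m + L) * ((L - m) / 2 * norm (x - y))"
    using sector_imp_ball[OF resid_sector m_le_L] mL
    unfolding q_def by (intro mult_left_mono) auto
  also have "\<dots> = (L - m) / (L + m) * norm (x - y)"
    by (simp only: scale add.commute[of L m])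
  finally show ?thesis .
qed

lemma gradient_rate_nonneg: "0 \<le> (L - m) / (L + m)"
  and gradient_rate_less_1: "(L - m) / (L + m) < 1"
proof -
  have "0 < L + m" "0 \<le> L - m" using m_gt_1 m_le_L by linarith+
  then show "0 \<le> (L - m) / (L + m)" by simp
  show "(L - m) / (L + m) < 1"
    unfolding divide_less_eq_1_pos[OF \<open>0 < L + m\<close>] using m_gt_1 by linarith
qed

text \<open>Zeros of the residual are the fixed points of the contractive gradient step, so Banach's
  theorem applies.\<close>

lemma ex_resid_zero: "\<exists>p. resid z p = 0"
proof -
  have "\<exists>!p. p - (2 / (m + L)) *\<^sub>R resid z p = p"
    by (rule banach_fix_type[OF gradient_rate_nonneg gradient_rate_less_1])
      (use gradient_step_contraction in \<open>auto simp: dist_norm\<close>)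
  then obtain p where "(2 / (m + L)) *\<^sub>R resid z p = 0" by auto
  moreover have "0 < m + L" using m_gt_1 m_le_L by linarith
  ultimately show ?thesis by auto
qed

text \<open>A zero residual means \<open>z - p = \<gamma> *\<^sub>R grad f p\<close>, and the
  variational inequality becomes \<gamma> times the gradient inequality at \<open>p\<close>.\<close>

lemma resid_zero_imp_is_prox:
  assumes "resid z p = 0"
  shows "is_prox \<gamma> (\<lambda>x. ereal (f x)) z p"
proof -
  have zp: "z - p = \<gamma> *\<^sub>R grad f p"
    using assms by (simp add: resid_def algebra_simps)
  have "\<gamma> * f p + (z - p) \<bullet> (y - p) \<le> \<gamma> * s" if "f y \<le> s" for y s
  proof -
    have "f p + grad f p \<bullet> (y - p) \<le> f y"
      using lower_quadratic[of p y] sigma_pos zero_le_power2[of "norm (y - p)"]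
        mult_nonneg_nonneg[of "\<sigma> / 2" "(norm (y - p))\<^sup>2"] by linarith
    then have "\<gamma> * (f p + grad f p \<bullet> (y - p)) \<le> \<gamma> * s"
      using gamma_pos that by simp
    then show ?thesis by (simp add: zp algebra_simps)
  qed
  then show ?thesis by (auto simp: is_prox_def)
qed

lemma resid_P_f: "resid z (P_f z) = 0"
  using ex_resid_zero resid_zero_imp_is_prox is_prox_imp_prox[OF gamma_pos] by metis

text \<open>Since the residual vanishes at \<open>P_f z\<close>, the sector bounds make its norm a
  computable measure of the distance to that unknown point.\<close>

lemma resid_bounds:
  "m * norm (x - P_f z) \<le> norm (resid z x)" "norm (resid z x) \<le> L * norm (x - P_f z)"
  using sector_norm_bounds[OF resid_sector[of z x "P_f z"]] m_gt_1 m_le_L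
  by (auto simp: resid_P_f)

text \<open>The residual with centre \<open>v\<close>, evaluated at \<open>P_f u\<close>, is exactly
  \<open>u - v\<close>.\<close>

lemma P_f_lipschitz: "norm (P_f u - P_f v) \<le> 1 / m * norm (u - v)"
proof -
  have "resid v (P_f u) = u - v"
    using resid_P_f[of u] by (simp add: resid_def algebra_simps)
  then have "m * norm (P_f u - P_f v) \<le> norm (u - v)"
    using resid_bounds(1)[of "P_f u" v] by simp
  then show ?thesis using m_gt_1 by (simp add: field_simps)
qed

section \<open>Contraction of the reflection and of the DRS map\<close>

abbreviation "\<delta> \<equiv> max ((\<gamma> * \<beta> - 1) / (\<gamma> * \<beta> + 1)) ((1 - \<gamma> * \<sigma>) / (1 + \<gamma> * \<sigma>))"

text \<open>The two entries of the maximum have nonnegative sum. This gives both the sign of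
  \<delta> and the order of the sector endpoints for the reflection.\<close>

lemma delta_average_nonneg:
  "- ((\<gamma> * \<beta> - 1) / (\<gamma> * \<beta> + 1)) \<le> (1 - \<gamma> * \<sigma>) / (1 + \<gamma> * \<sigma>)"
proof -
  have "0 < \<gamma> * \<sigma>" "\<gamma> * \<sigma> \<le> \<gamma> * \<beta>"
    using sigma_pos sigma_le_beta gamma_pos by auto
  moreover from this
  have "(1 - \<gamma> * \<sigma>) / (1 + \<gamma> * \<sigma>) + (\<gamma> * \<beta> - 1) / (\<gamma> * \<beta> + 1)
      = 2 * (\<gamma> * \<beta> - \<gamma> * \<sigma>) / ((1 + \<gamma> * \<sigma>) * (\<gamma> * \<beta> + 1))"
    by (subst add_frac_eq) (auto simp: algebra_simps)
  moreover have "0 \<le> 2 * (\<gamma> * \<beta> - \<gamma> * \<sigma>) / ((1 + \<gamma> * \<sigma>) * (\<gamma> * \<beta> + 1))"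
    using calculation(1,2) by simp
  ultimately show ?thesis by linarith
qed

lemma delta_nonneg: "0 \<le> \<delta>"
  using delta_average_nonneg by linarith

text \<open>With \<open>G\<close> the scaled gradient difference, inputs differ by
  \<open>p + G\<close> and outputs by \<open>p - G\<close>. This Cayley transform maps the slopes
  \<open>\<gamma> * \<sigma>\<close> and \<open>\<gamma> * \<beta>\<close> to \<open>a\<close> and
  \<open>- b\<close>, so the sector of \<open>(p, G)\<close> becomes one of \<open>(U, W)\<close>
  with these endpoints.\<close>

lemma reflection_contraction:
  "norm ((2 *\<^sub>R P_f u - u) - (2 *\<^sub>R P_f v - v)) \<le> \<delta> * norm (u - v)"
proof -
  define a where "a = (1 - \<gamma> * \<sigma>) / (1 + \<gamma> * \<sigma>)"
  define b where "b = (\<gamma> * \<beta> - 1) / (\<gamma> * \<beta> + 1)"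
  define p where "p = P_f u - P_f v"
  define G where "G = \<gamma> *\<^sub>R (grad f (P_f u) - grad f (P_f v))"
  define U where "U = u - v"
  define W where "W = (2 *\<^sub>R P_f u - u) - (2 *\<^sub>R P_f v - v)"
  have gb: "0 < \<gamma> * \<beta>" "0 < \<gamma> * \<sigma>"
    using sigma_pos sigma_le_beta gamma_pos by auto
  have "u = \<gamma> *\<^sub>R grad f (P_f u) + P_f u" "v = \<gamma> *\<^sub>R grad f (P_f v) + P_f v"
    using resid_P_f[of u] resid_P_f[of v] by (simp_all add: resid_def)
  then have U: "U = p + G"
    by (simp add: U_def p_def G_def algebra_simps)
  then have W: "W = p - G"
    by (simp add: W_def U_def p_def G_def algebra_simps scaleR_2)
  have "a *\<^sub>R U - W = (2 / (1 + \<gamma> * \<sigma>)) *\<^sub>R (G - (\<gamma> * \<sigma>) *\<^sub>R p)"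
  proof -
    have "a + 1 = 2 / (1 + \<gamma> * \<sigma>)" "1 - a = 2 / (1 + \<gamma> * \<sigma>) * (\<gamma> * \<sigma>)"
      using gb by (auto simp: a_def field_simps)
    then have "(a + 1) *\<^sub>R G - (1 - a) *\<^sub>R p = (2 / (1 + \<gamma> * \<sigma>)) *\<^sub>R (G - (\<gamma> * \<sigma>) *\<^sub>R p)"
      by (simp add: scaleR_diff_right)
    then show ?thesis by (simp add: U W algebra_simps)
  qed
  moreover have "W - (- b) *\<^sub>R U = (2 / (\<gamma> * \<beta> + 1)) *\<^sub>R ((\<gamma> * \<beta>) *\<^sub>R p - G)"
  proof -
    have "1 + b = 2 / (\<gamma> * \<beta> + 1) * (\<gamma> * \<beta>)" "1 - b = 2 / (\<gamma> * \<beta> + 1)"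
      using gb by (auto simp: b_def field_simps)
    then have "(1 + b) *\<^sub>R p - (1 - b) *\<^sub>R G = (2 / (\<gamma> * \<beta> + 1)) *\<^sub>R ((\<gamma> * \<beta>) *\<^sub>R p - G)"
      by (simp add: scaleR_diff_right)
    then show ?thesis by (simp add: U W algebra_simps)
  qed
  moreover have "0 \<le> (G - (\<gamma> * \<sigma>) *\<^sub>R p) \<bullet> ((\<gamma> * \<beta>) *\<^sub>R p - G)"
  proof -
    have "G - (\<gamma> * \<sigma>) *\<^sub>R p = \<gamma> *\<^sub>R (grad f (P_f u) - grad f (P_f v) - \<sigma> *\<^sub>R p)"
      "(\<gamma> * \<beta>) *\<^sub>R p - G = \<gamma> *\<^sub>R (\<beta> *\<^sub>R p - (grad f (P_f u) - grad f (P_f v)))"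
      by (simp_all add: G_def algebra_simps)
    then show ?thesis
      using grad_sector[of "P_f u" "P_f v"] gamma_pos by (simp add: p_def)
  qed
  ultimately have "0 \<le> (W - (- b) *\<^sub>R U) \<bullet> (a *\<^sub>R U - W)"
    using gb by (simp add: inner_commute)
  moreover have "- b \<le> a"
    using delta_average_nonneg by (simp add: a_def b_def)
  ultimately have "norm (W - ((- b + a) / 2) *\<^sub>R U) \<le> (a - - b) / 2 * norm U"
    by (rule sector_imp_ball)
  moreover have "norm W \<le> norm (W - ((- b + a) / 2) *\<^sub>R U) + \<bar>(- b + a) / 2\<bar> * norm U"
    using norm_triangle_ineq[of "W - ((- b + a) / 2) *\<^sub>R U" "((- b + a) / 2) *\<^sub>R U"] by simp
  ultimately have "norm W \<le> ((a - - b) / 2 + \<bar>(- b + a) / 2\<bar>) * norm U"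
    unfolding distrib_right by linarith
  \<comment> \<open>Radius plus distance of the centre from the origin is the larger modulus of the
    two endpoints.\<close>
  also have "(a - - b) / 2 + \<bar>(- b + a) / 2\<bar> = max b a"
    by (auto simp: max_def abs_if field_simps)
  finally show ?thesis
    by (simp add: W_def U_def a_def b_def)
qed

lemma drs_map_contraction:
  assumes g: "proper_closed_convex g" and "0 \<le> \<alpha>"
  shows "norm (drs_map \<gamma> \<alpha> f g u - drs_map \<gamma> \<alpha> f g v) \<le> (\<bar>1 - \<alpha>\<bar> + \<alpha> * \<delta>) * norm (u - v)"
proof -
  define R where "R = (\<lambda>z. 2 *\<^sub>R P_f z - z)"
  define S where "S = (\<lambda>z. refl_prox \<gamma> g (R z))"
  have T: "drs_map \<gamma> \<alpha> f g z = (1 - \<alpha>) *\<^sub>R z + \<alpha> *\<^sub>R S z" for z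
    by (simp add: drs_map_def S_def R_def refl_prox_def)
  have "norm (S u - S v) \<le> norm (R u - R v)"
    unfolding S_def by (rule refl_prox_nonexpansive[OF g gamma_pos])
  also have "\<dots> \<le> \<delta> * norm (u - v)"
    unfolding R_def by (rule reflection_contraction)
  finally have S: "norm (S u - S v) \<le> \<delta> * norm (u - v)" .
  have "drs_map \<gamma> \<alpha> f g u - drs_map \<gamma> \<alpha> f g v = (1 - \<alpha>) *\<^sub>R (u - v) + \<alpha> *\<^sub>R (S u - S v)"
    by (simp add: T algebra_simps)
  then have "norm (drs_map \<gamma> \<alpha> f g u - drs_map \<gamma> \<alpha> f g v)
      \<le> \<bar>1 - \<alpha>\<bar> * norm (u - v) + \<alpha> * norm (S u - S v)"
    using norm_triangle_ineq[of "(1 - \<alpha>) *\<^sub>R (u - v)" "\<alpha> *\<^sub>R (S u - S v)"] \<open>0 \<le> \<alpha>\<close> by simp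
  also have "\<dots> \<le> \<bar>1 - \<alpha>\<bar> * norm (u - v) + \<alpha> * (\<delta> * norm (u - v))"
    using S \<open>0 \<le> \<alpha>\<close> by (intro add_left_mono mult_left_mono) auto
  finally show ?thesis by (simp add: algebra_simps)
qed

text \<open>At a fixed point both proximal points coincide. The optimality condition for
  \<open>g\<close> then reads \<open>- grad f p\<close> as a subgradient of \<open>g\<close> at
  \<open>p\<close>, and strong convexity of \<open>f\<close> makes \<open>p\<close> strictly better
  than any other point.\<close>

lemma minimizer_of_fixed_point:
  assumes g: "proper_closed_convex g" and "\<alpha> \<noteq> 0" and fixed: "drs_map \<gamma> \<alpha> f g z = z"
  shows "{u. is_arg_min (\<lambda>v. ereal (f v) + g v) (\<lambda>_. True) u} = {P_f z}"
proof -
  define p where "p = P_f z"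
  define y where "y = prox \<gamma> g (2 *\<^sub>R p - z)"
  have "\<alpha> *\<^sub>R (refl_prox \<gamma> g (2 *\<^sub>R p - z) - z) = 0"
    using fixed by (simp add: drs_map_def refl_prox_def[of \<gamma> "\<lambda>x. ereal (f x)"] p_def algebra_simps)
  then have "2 *\<^sub>R y - (2 *\<^sub>R p - z) = z"
    using \<open>\<alpha> \<noteq> 0\<close> by (simp add: refl_prox_def y_def)
  then have "2 *\<^sub>R y = 2 *\<^sub>R p" by simp
  then have "y = p" by simp
  then have "is_prox \<gamma> g (2 *\<^sub>R p - z) p"
    using is_prox_prox[OF g gamma_pos, of "2 *\<^sub>R p - z"] by (simp add: y_def)
  then obtain r where r: "g p = ereal r"
    and var: "\<And>y s. g y \<le> ereal s \<Longrightarrow> \<gamma> * r + (2 *\<^sub>R p - z - p) \<bullet> (y - p) \<le> \<gamma> * s"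
    unfolding is_prox_def by blast
  have gp: "2 *\<^sub>R p - z - p = - (\<gamma> *\<^sub>R grad f p)"
    using resid_P_f[of z] by (simp add: resid_def p_def[symmetric] algebra_simps scaleR_2)
  have less: "ereal (f p) + g p < ereal (f u) + g u" if "u \<noteq> p" for u
  proof (cases "g u")
    case (real s)
    have "\<gamma> * r - \<gamma> * (grad f p \<bullet> (u - p)) \<le> \<gamma> * s"
      using var[of u s] by (simp add: gp real)
    then have "\<gamma> * (r - grad f p \<bullet> (u - p)) \<le> \<gamma> * s"
      by (simp add: algebra_simps)
    then have "r - grad f p \<bullet> (u - p) \<le> s" using gamma_pos by simp
    moreover have "0 < \<sigma> / 2 * (norm (u - p))\<^sup>2" using that sigma_pos by simp
    ultimately have "f p + r < f u + s" using lower_quadratic[of p u] by linarith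
    then show ?thesis by (simp add: r real)
  next
    case PInf
    then show ?thesis by (simp add: r)
  next
    case MInf
    then show ?thesis using g by (simp add: proper_closed_convex_def)
  qed
  then show ?thesis
    unfolding is_arg_min_def p_def[symmetric] by (auto dest: less_asym)
qed

section \<open>One inexact iteration\<close>

lemma fallback_error:
  assumes "gam P = \<gamma>" "sc P = \<sigma>" "sm P = \<beta>"
  shows "norm (fallback P f z a - P_f z) \<le> ((L - m) / (L + m)) ^ fb_steps P * norm (a - P_f z)"
proof -
  define step where "step = (\<lambda>u. u - (2 / (m + L)) *\<^sub>R resid z u)"
  have "norm ((step ^^ n) a - P_f z) \<le> ((L - m) / (L + m)) ^ n * norm (a - P_f z)" for n
  proof (induction n)
    case (Suc n)
    have "norm (step ((step ^^ n) a) - P_f z) \<le> (L - m) / (L + m) * norm ((step ^^ n) a - P_f z)"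
      using gradient_step_contraction[of "(step ^^ n) a" z "P_f z"]
      by (simp only: step_def resid_P_f scaleR_zero_right diff_zero)
    also have "\<dots> \<le> (L - m) / (L + m) * (((L - m) / (L + m)) ^ n * norm (a - P_f z))"
      by (rule mult_left_mono[OF Suc.IH gradient_rate_nonneg])
    finally show ?case by (simp only: funpow.simps o_apply power_Suc mult.assoc)
  qed simp
  moreover have "fallback P f z a = (step ^^ fb_steps P) a"
    unfolding fallback_def step_def m_const_def L_const_def res_def resid_def assms ..
  ultimately show ?thesis by simp
qed

text \<open>Passing from distance to residual and back costs the factor \<open>L / m\<close>, which
  the factor \<open>m / L\<close> in the residual test cancels.\<close>

lemma accepted_error:
  assumes "gam P = \<gamma>" "sc P = \<sigma>" "sm P = \<beta>" and "0 \<le> theta_Q P"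
    and "accepts P f z a u"
  shows "norm (u - P_f z) \<le> theta_Q P * norm (a - P_f z)"
proof -
  have L: "0 < L" and m: "0 < m" using m_gt_1 m_le_L by linarith+
  have "m * norm (u - P_f z) \<le> norm (resid z u)"
    by (rule resid_bounds)
  also have "\<dots> \<le> m / L * theta_Q P * norm (resid z a)"
    using assms(5) unfolding accepts_def res_def m_const_def L_const_def resid_def assms(1-3)
    by blast
  also have "\<dots> \<le> m / L * theta_Q P * (L * norm (a - P_f z))"
    using resid_bounds(2) L m assms(4) by (intro mult_left_mono) auto
  also have "\<dots> = m * (theta_Q P * norm (a - P_f z))"
    using L by simp
  finally show ?thesis using m by (simp only: mult_le_cancel_left_pos)
qed

text \<open>The bound is independent of the memory: whatever the quasi-Newton model proposes is
  either certified by the tests or replaced by the fallback.\<close>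

lemma corrected_point_error:
  assumes P: "gam P = \<gamma>" "sc P = \<sigma>" "sm P = \<beta>" and "0 \<le> theta_Q P"
  shows "norm (corrected_point P f mem z a - P_f z)
    \<le> max (theta_Q P) (((L - m) / (L + m)) ^ fb_steps P) * norm (a - P_f z)"
proof -
  let ?x = "corrected_point P f mem z a"
  have "norm (?x - P_f z) \<le> theta_Q P * norm (a - P_f z) \<or>
      norm (?x - P_f z) \<le> ((L - m) / (L + m)) ^ fb_steps P * norm (a - P_f z)"
    unfolding corrected_point_def Let_def
    using accepted_error[OF assms] fallback_error[OF P] by simp
  then show ?thesis
    by (rule disjE) (erule order_trans, rule mult_right_mono, simp_all)+
qed

text \<open>Exact and inexact step differ only in the argument of the nonexpansive reflection of
  \<open>g\<close>, where the error of \<open>x\<close> enters doubled.\<close>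

lemma inexact_drs_step_error:
  assumes g: "proper_closed_convex g" and "0 \<le> \<alpha>"
  shows "norm (z + (2 * \<alpha>) *\<^sub>R (prox \<gamma> g (2 *\<^sub>R x - z) - x) - drs_map \<gamma> \<alpha> f g z)
    \<le> 2 * \<alpha> * norm (x - P_f z)"
proof -
  define S where "S = refl_prox \<gamma> g (2 *\<^sub>R x - z) - refl_prox \<gamma> g (2 *\<^sub>R P_f z - z)"
  have "z + (2 * \<alpha>) *\<^sub>R (prox \<gamma> g (2 *\<^sub>R x - z) - x) - drs_map \<gamma> \<alpha> f g z = \<alpha> *\<^sub>R S"
    by (simp add: S_def drs_map_def refl_prox_def algebra_simps)
  moreover have "norm S \<le> 2 * norm (x - P_f z)"
  proof -
    have "norm S \<le> norm ((2 *\<^sub>R x - z) - (2 *\<^sub>R P_f z - z))"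
      unfolding S_def by (rule refl_prox_nonexpansive[OF g gamma_pos])
    also have "(2 *\<^sub>R x - z) - (2 *\<^sub>R P_f z - z) = 2 *\<^sub>R (x - P_f z)"
      by (simp add: algebra_simps)
    finally show ?thesis by simp
  qed
  ultimately show ?thesis
    using \<open>0 \<le> \<alpha>\<close> mult_left_mono[of "norm S" "2 * norm (x - P_f z)" \<alpha>] by simp
qed

text \<open>The correction starts from the old \<open>x\<close> but aims at the new
  \<open>P_f z'\<close>. Its initial error is at most the old error plus the drift of the target,
  which the Lipschitz bound controls by \<open>norm (z - z') / m\<close>.\<close>

lemma error_recursion:
  assumes g: "proper_closed_convex g" and "0 \<le> \<alpha>"
    and fixed: "drs_map \<gamma> \<alpha> f g z_star = z_star"
    and z': "z' = z + (2 * \<alpha>) *\<^sub>R (prox \<gamma> g (2 *\<^sub>R x - z) - x)"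
    and x': "norm (x' - P_f z') \<le> \<theta> * norm (x - P_f z')" and "0 \<le> \<theta>"
  defines "\<rho> \<equiv> \<bar>1 - \<alpha>\<bar> + \<alpha> * \<delta>"
  shows "norm (z' - z_star) \<le> \<rho> * norm (z - z_star) + 2 * \<alpha> * norm (x - P_f z)"
    and "norm (x' - P_f z') \<le> \<theta> * (1 / m) * (1 + \<rho>) * norm (z - z_star)
      + \<theta> * (1 + 2 * \<alpha> * (1 / m)) * norm (x - P_f z)"
proof -
  let ?T = "drs_map \<gamma> \<alpha> f g z"
  define A where "A = norm (z - z_star)"
  define E where "E = norm (x - P_f z)"
  have step: "norm (z' - ?T) \<le> 2 * \<alpha> * E"
    unfolding z' E_def by (rule inexact_drs_step_error[OF g \<open>0 \<le> \<alpha>\<close>])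
  have contr: "norm (?T - z_star) \<le> \<rho> * A"
    using drs_map_contraction[OF g \<open>0 \<le> \<alpha>\<close>, of z z_star] by (simp only: fixed \<rho>_def A_def)
  show "norm (z' - z_star) \<le> \<rho> * norm (z - z_star) + 2 * \<alpha> * norm (x - P_f z)"
    unfolding A_def[symmetric] E_def[symmetric]
    using norm_triangle_ineq[of "z' - ?T" "?T - z_star"] step contr by simp
  \<comment> \<open>The displacement is routed through the exact image \<open>?T\<close> and the
    fixed point, which produces the factor \<open>1 + \<rho>\<close>.\<close>
  have "norm (z' - z) \<le> norm (z' - ?T) + norm (?T - z_star) + norm (z - z_star)"
    using norm_triangle_ineq[of "z' - ?T" "?T - z"] norm_triangle_ineq4[of "?T - z_star" "z - z_star"]
    by simp
  then have "norm (z - z') \<le> (1 + \<rho>) * A + 2 * \<alpha> * E"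
    using step contr A_def by (simp add: norm_minus_commute algebra_simps)
  then have "1 / m * norm (z - z') \<le> 1 / m * ((1 + \<rho>) * A + 2 * \<alpha> * E)"
    using m_gt_1 by (intro mult_left_mono) auto
  then have "norm (x - P_f z') \<le> E + 1 / m * ((1 + \<rho>) * A + 2 * \<alpha> * E)"
    using norm_triangle_ineq[of "x - P_f z" "P_f z - P_f z'"] P_f_lipschitz[of z z'] E_def by simp
  then have "norm (x' - P_f z') \<le> \<theta> * (E + 1 / m * ((1 + \<rho>) * A + 2 * \<alpha> * E))"
    using x' mult_left_mono[OF _ \<open>0 \<le> \<theta>\<close>] order_trans by blast
  also have "\<dots> = \<theta> * (1 / m) * (1 + \<rho>) * A + \<theta> * (1 + 2 * \<alpha> * (1 / m)) * E"
    by (simp only: distrib_left distrib_right mult_ac mult_1_right mult_1_left add_ac)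
  finally show "norm (x' - P_f z') \<le> \<theta> * (1 / m) * (1 + \<rho>) * norm (z - z_star)
      + \<theta> * (1 + 2 * \<alpha> * (1 / m)) * norm (x - P_f z)"
    unfolding A_def E_def .
qed

lemma ex1_drs_fixed_point:
  assumes "proper_closed_convex g" and "0 \<le> \<alpha>" and "\<bar>1 - \<alpha>\<bar> + \<alpha> * \<delta> < 1"
  shows "\<exists>!z. drs_map \<gamma> \<alpha> f g z = z"
proof (rule banach_fix_type[OF _ assms(3)])
  show "0 \<le> \<bar>1 - \<alpha>\<bar> + \<alpha> * \<delta>"
    using delta_nonneg \<open>0 \<le> \<alpha>\<close> by (intro add_nonneg_nonneg mult_nonneg_nonneg) auto
qed (use drs_map_contraction[OF assms(1,2)] in \<open>simp add: dist_norm\<close>)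

end

section \<open>Nonnegative matrices of size two\<close>

lemma dim_vec_2_conv_vec_of_list:
  assumes "dim_vec v = 2"
  shows "v = vec_of_list [v $ 0, v $ 1]"
  by (rule eq_vecI) (auto simp: assms vec_of_list_index less_Suc_eq)

lemma vec_of_list_2_eq_iff:
  "vec_of_list [x, y] = vec_of_list [x', y'] \<longleftrightarrow> x = x' \<and> y = y'"
  by (metis list.inject list_vec)

lemma vec_of_list_2_le_iff:
  "vec_of_list [x, y] \<le> vec_of_list [x', y'] \<longleftrightarrow> x \<le> x' \<and> y \<le> y'"
  by (auto simp: less_eq_vec_def vec_of_list_index less_Suc_eq)

lemma zero_vec_2: "0\<^sub>v 2 = vec_of_list [0, 0]"
  by (subst dim_vec_2_conv_vec_of_list) simp_all

lemma smult_vec_of_list_2: "k \<cdot>\<^sub>v vec_of_list [x, y] = vec_of_list [k * x, k * y]"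
  by (subst dim_vec_2_conv_vec_of_list) (simp_all add: vec_of_list_index)

lemma mult_mat_vec_2:
  fixes a b c d x y :: "'a::comm_semiring_1"
  shows "mat_of_rows_list 2 [[a, b], [c, d]] *\<^sub>v vec_of_list [x, y]
    = vec_of_list [a * x + b * y, c * x + d * y]"
  by (subst dim_vec_2_conv_vec_of_list)
    (simp_all add: mat_of_rows_list_def scalar_prod_def vec_of_list_index numeral_2_eq_2)

text \<open>Elimination shows that the characteristic polynomial annihilates both coordinates of an
  eigenvector. Conversely, \<open>b \<noteq> 0\<close> makes \<open>(b, k - a)\<close> a nonzero
  eigenvector at each root.\<close>

lemma eigenvalue_2_iff:
  fixes a b c d k :: "'a::field"
  assumes "b \<noteq> 0"
  shows "eigenvalue (mat_of_rows_list 2 [[a, b], [c, d]]) k \<longleftrightarrow> (k - a) * (k - d) = b * c"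
proof -
  let ?A = "mat_of_rows_list 2 [[a, b], [c, d]]"
  have "dim_row ?A = 2" by (simp add: mat_of_rows_list_def)
  then have "eigenvector ?A v k \<longleftrightarrow> dim_vec v = 2 \<and> v \<noteq> 0\<^sub>v 2 \<and> ?A *\<^sub>v v = k \<cdot>\<^sub>v v" for v
    unfolding eigenvector_def by (metis carrier_vecD carrier_vecI)
  moreover have "dim_vec (vec_of_list [x, y]) = 2" for x y :: 'a by simp
  ultimately have "eigenvalue ?A k \<longleftrightarrow>
      (\<exists>x y. vec_of_list [x, y] \<noteq> 0\<^sub>v 2 \<and> ?A *\<^sub>v vec_of_list [x, y] = k \<cdot>\<^sub>v vec_of_list [x, y])"
    unfolding eigenvalue_def by (metis dim_vec_2_conv_vec_of_list)
  also have "\<dots> \<longleftrightarrow> (\<exists>x y. (x \<noteq> 0 \<or> y \<noteq> 0) \<and> a * x + b * y = k * x \<and> c * x + d * y = k * y)"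
    unfolding zero_vec_2 mult_mat_vec_2 smult_vec_of_list_2 vec_of_list_2_eq_iff by blast
  also have "\<dots> \<longleftrightarrow> (k - a) * (k - d) = b * c"
  proof
    assume "\<exists>x y. (x \<noteq> 0 \<or> y \<noteq> 0) \<and> a * x + b * y = k * x \<and> c * x + d * y = k * y"
    then obtain x y where nz: "x \<noteq> 0 \<or> y \<noteq> 0"
      and "a * x + b * y = k * x" "c * x + d * y = k * y" by blast
    then have x: "b * y = (k - a) * x" and y: "c * x = (k - d) * y"
      by (simp_all add: algebra_simps)
    have "((k - a) * (k - d) - b * c) * x = (k - d) * ((k - a) * x) - b * (c * x)"
      by (simp add: algebra_simps)
    also have "\<dots> = 0" by (simp flip: x add: y mult.left_commute)
    finally have x0: "((k - a) * (k - d) - b * c) * x = 0" .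
    have "((k - a) * (k - d) - b * c) * y = (k - a) * ((k - d) * y) - c * (b * y)"
      by (simp add: algebra_simps)
    also have "\<dots> = 0" by (simp flip: y add: x mult.left_commute)
    finally show "(k - a) * (k - d) = b * c" using x0 nz by auto
  next
    assume "(k - a) * (k - d) = b * c"
    then have "a * b + b * (k - a) = k * b" "c * b + d * (k - a) = k * (k - a)"
      by (simp_all add: algebra_simps)
    with assms show "\<exists>x y. (x \<noteq> 0 \<or> y \<noteq> 0) \<and> a * x + b * y = k * x \<and> c * x + d * y = k * y"
      by blast
  qed
  finally show ?thesis .
qed

text \<open>The larger root \<open>k\<close> is real and exceeds \<open>a\<close> and
  \<open>d\<close>, so \<open>k < 1\<close> yields
  \<open>b * c = (k - a) * (k - d) < (1 - a) * (1 - d)\<close>. Conversely, an eigenvalue of modulus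
  at least 1 is at distance at least \<open>1 - a\<close> and \<open>1 - d\<close> from the diagonal
  entries, too far for its product \<open>b * c\<close>.\<close>

lemma spectral_radius_2_less_1_iff:
  fixes a b c d :: real
  assumes "0 \<le> a" "a < 1" "0 < b" "0 < c" "0 \<le> d"
  shows "spectral_radius (map_mat complex_of_real (mat_of_rows_list 2 [[a, b], [c, d]])) < 1
    \<longleftrightarrow> d < 1 \<and> b * c < (1 - a) * (1 - d)" (is "spectral_radius ?M < 1 \<longleftrightarrow> _")
proof -
  have M: "?M = mat_of_rows_list 2
      [[complex_of_real a, complex_of_real b], [complex_of_real c, complex_of_real d]]"
    by (rule eq_matI) (auto simp: mat_of_rows_list_def less_Suc_eq dest!: less_2_cases)
  have carrier: "?M \<in> carrier_mat 2 2"
    by (intro carrier_matI) (simp_all add: mat_of_rows_list_def)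
  have ev: "eigenvalue ?M k \<longleftrightarrow>
      (k - complex_of_real a) * (k - complex_of_real d) = complex_of_real (b * c)" for k
    unfolding M of_real_mult by (rule eigenvalue_2_iff) (use assms in simp)
  show ?thesis
  proof
    assume sr: "spectral_radius ?M < 1"
    \<comment> \<open>The square root of the discriminant; \<open>k\<close> is the larger (Perron)
      root.\<close>
    define s where "s = sqrt ((a - d)\<^sup>2 + 4 * (b * c))"
    define k where "k = (a + d + s) / 2"
    have "0 < b * c" using assms by simp
    then have s2: "s\<^sup>2 = (a - d)\<^sup>2 + 4 * (b * c)"
      by (simp add: s_def)
    have "\<bar>a - d\<bar> < s"
      unfolding s_def using \<open>0 < b * c\<close> by (intro real_less_rsqrt) simp
    then have ka: "0 < k - a" and kd: "0 < k - d"
      by (auto simp: k_def abs_less_iff field_simps)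
    have root: "(k - a) * (k - d) = b * c"
      using s2 by (simp add: k_def power2_eq_square field_simps)
    then have "eigenvalue ?M (complex_of_real k)"
      unfolding ev by (metis of_real_diff of_real_mult)
    then have "norm (complex_of_real k) \<in> norm ` spectrum ?M"
      unfolding spectrum_def by blast
    then have "norm (complex_of_real k) \<le> spectral_radius ?M"
      using spectral_radius_mem_max(2)[OF carrier] by simp
    then have "k < 1" using sr by simp
    moreover have "(k - a) * (k - d) < (1 - a) * (1 - d)"
      using ka kd \<open>k < 1\<close> by (intro mult_strict_mono) auto
    ultimately show "d < 1 \<and> b * c < (1 - a) * (1 - d)"
      using kd root by simp
  next
    assume cond: "d < 1 \<and> b * c < (1 - a) * (1 - d)"
    have "norm k < 1" if "eigenvalue ?M k" for k
    proof (rule ccontr)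
      assume "\<not> norm k < 1"
      then have "1 - a \<le> norm (k - complex_of_real a)" "1 - d \<le> norm (k - complex_of_real d)"
        using norm_triangle_ineq2[of k "complex_of_real a"]
          norm_triangle_ineq2[of k "complex_of_real d"] assms by auto
      then have "(1 - a) * (1 - d) \<le> norm (k - complex_of_real a) * norm (k - complex_of_real d)"
        using assms cond by (intro mult_mono) auto
      also have "\<dots> = norm (complex_of_real (b * c))"
        using that unfolding ev by (simp flip: norm_mult)
      also have "\<dots> = b * c" using assms by (simp only: norm_of_real) simp
      finally show False using cond by simp
    qed
    then show "spectral_radius ?M < 1"
      using spectral_radius_mem_max(1)[OF carrier] by (auto simp: spectrum_def)
  qed
qed

text \<open>The weight \<open>(1, w)\<close> is a positive left subsolution, so it turns the componentwise
  recursion into a scalar geometric decay.\<close>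

lemma nonneg_2_recursion_geometric:
  fixes A E :: "nat \<Rightarrow> real" and a b c d :: real
  assumes coeffs: "0 \<le> a" "a < 1" "0 < b" "0 < c" "d < 1" "b * c < (1 - a) * (1 - d)"
    and nonneg: "\<And>k. 0 \<le> A k" "\<And>k. 0 \<le> E k"
    and A_Suc: "\<And>k. A (Suc k) \<le> a * A k + b * E k"
    and E_Suc: "\<And>k. E (Suc k) \<le> c * A k + d * E k"
  shows "\<exists>C>0. \<exists>q. 0 < q \<and> q < 1 \<and> (\<forall>k. A k \<le> C * q ^ k \<and> E k \<le> C * q ^ k)"
proof -
  have "b / (1 - d) < (1 - a) / c"
    using coeffs by (simp add: field_simps)
  \<comment> \<open>The lower bound on \<open>w\<close> gives \<open>b + d * w < w\<close>, the
    upper one \<open>a + c * w < 1\<close>; the determinant condition leaves room between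
    them.\<close>
  then obtain w where w: "b / (1 - d) < w" "w < (1 - a) / c"
    using dense by blast
  have "0 < b / (1 - d)" using coeffs by simp
  with w(1) have "0 < w" by linarith
  define q where "q = max (a + c * w) ((b + d * w) / w)"
  have "0 < a + c * w" using coeffs \<open>0 < w\<close> by (simp add: add_nonneg_pos)
  then have "0 < q" by (simp add: q_def)
  have "q < 1"
    using w coeffs \<open>0 < w\<close> by (simp add: q_def field_simps)
  have qA: "a + c * w \<le> q" and qE: "b + d * w \<le> q * w"
    using \<open>0 < w\<close> by (auto simp: q_def simp flip: pos_divide_le_eq)
  define V where "V = (\<lambda>k. A k + w * E k)"
  have "V k \<le> V 0 * q ^ k" for k
  proof (induction k)
    case (Suc k)
    have "V (Suc k) \<le> (a * A k + b * E k) + w * (c * A k + d * E k)"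
      unfolding V_def using A_Suc E_Suc \<open>0 < w\<close> by (intro add_mono mult_left_mono) auto
    also have "\<dots> = (a + c * w) * A k + (b + d * w) * E k"
      by (simp add: algebra_simps)
    also have "\<dots> \<le> q * A k + q * w * E k"
      using qA qE nonneg by (intro add_mono mult_right_mono) auto
    also have "\<dots> = q * V k" by (simp add: V_def algebra_simps)
    also have "\<dots> \<le> q * (V 0 * q ^ k)"
      using Suc.IH \<open>0 < q\<close> by (intro mult_left_mono) auto
    finally show ?case by (simp add: mult_ac)
  qed simp
  note V_le = this
  \<comment> \<open>The factor \<open>1 / w\<close> recovers \<open>E\<close> from the weighted sum,
    and adding 1 keeps \<open>C\<close> positive when \<open>V 0 = 0\<close>.\<close>
  define C where "C = (V 0 + 1) * max 1 (1 / w)"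
  have V0: "0 \<le> V 0" using nonneg \<open>0 < w\<close> by (simp add: V_def)
  have "A k \<le> C * q ^ k \<and> E k \<le> C * q ^ k" for k
  proof
    have "V 0 * q ^ k \<le> (V 0 + 1) * q ^ k"
      using \<open>0 < q\<close> by (intro mult_right_mono) auto
    then have V: "V k \<le> (V 0 + 1) * q ^ k" using V_le[of k] by linarith
    have pos: "0 \<le> (V 0 + 1) * q ^ k" using V0 \<open>0 < q\<close> by simp
    have "A k \<le> V k" using nonneg \<open>0 < w\<close> by (simp add: V_def)
    also note V
    also have "(V 0 + 1) * q ^ k \<le> (V 0 + 1) * q ^ k * max 1 (1 / w)"
      using mult_left_mono[OF max.cobounded1[of 1 "1 / w"] pos] by simp
    finally show "A k \<le> C * q ^ k" by (simp add: C_def mult_ac)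
    have "w * E k \<le> (V 0 + 1) * q ^ k"
      using V nonneg[of k] by (simp add: V_def)
    then have "E k \<le> (V 0 + 1) * q ^ k * (1 / w)"
      using \<open>0 < w\<close> by (simp add: field_simps)
    also have "\<dots> \<le> (V 0 + 1) * q ^ k * max 1 (1 / w)"
      by (rule mult_left_mono[OF max.cobounded2 pos])
    finally show "E k \<le> C * q ^ k" by (simp add: C_def mult_ac)
  qed
  moreover have "0 < C" using V0 by (simp add: C_def less_max_iff_disj)
  ultimately show ?thesis using \<open>0 < q\<close> \<open>q < 1\<close> by blast
qed

section \<open>Convergence\<close>

theorem theorem3p1:
  fixes f :: "'a::euclidean_space \<Rightarrow> real" and g :: "'a \<Rightarrow> ereal"
    and \<sigma> \<beta> \<gamma> \<alpha> c_A \<theta>\<^sub>Q \<nu>\<^sub>q\<^sub>n \<eta>_bar \<epsilon>\<^sub>c\<^sub>u\<^sub>r\<^sub>v \<epsilon>\<^sub>s\<^sub>r\<^sub>1 h_low h_high vtheta_0 :: real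
    and K b :: nat and m_q :: enat and update :: update_type
    and P :: crdrs_params
    and z a x :: "nat \<Rightarrow> 'a" and mem :: "nat \<Rightarrow> ('a \<times> 'a) list"
    and \<delta> \<rho> m L \<theta>\<^sub>G \<theta> L\<^sub>p c :: real and M :: "real mat"
  assumes f: "convex_on UNIV f" "twice_continuously_differentiable f"
      "strongly_convex \<sigma> f" "\<beta>-lipschitz_on UNIV (grad f)"
    and g: "proper_closed_convex g"
    and pos: "0 < \<sigma>" "\<sigma> \<le> \<beta>" "0 < \<gamma>" "0 < \<alpha>"
    and delta: "\<delta> = max ((\<gamma> * \<beta> - 1) / (\<gamma> * \<beta> + 1)) ((1 - \<gamma> * \<sigma>) / (1 + \<gamma> * \<sigma>))"
    and rho: "\<rho> = \<bar>1 - \<alpha>\<bar> + \<alpha> * \<delta>" "\<rho> < 1"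
    and params: "1 \<le> b" "1 \<le> m_q" "0 < c_A" "c_A < 1 / 2" "0 < \<theta>\<^sub>Q" "\<theta>\<^sub>Q < 1"
      "0 < \<nu>\<^sub>q\<^sub>n" "\<nu>\<^sub>q\<^sub>n < 2" "0 < \<eta>_bar" "\<eta>_bar \<le> 1" "0 \<le> \<epsilon>\<^sub>c\<^sub>u\<^sub>r\<^sub>v" "\<epsilon>\<^sub>c\<^sub>u\<^sub>r\<^sub>v < 1"
      "0 < \<epsilon>\<^sub>s\<^sub>r\<^sub>1" "\<epsilon>\<^sub>s\<^sub>r\<^sub>1 < 1" "0 < h_low" "h_low \<le> h_high" "h_low \<le> vtheta_0" "vtheta_0 \<le> h_high"
    and P: "P = \<lparr> sc = \<sigma>, sm = \<beta>, gam = \<gamma>, relax = \<alpha>, pred_steps = K, fb_steps = b,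
      mem_cap = m_q, armijo = c_A, theta_Q = \<theta>\<^sub>Q, nu_qn = \<nu>\<^sub>q\<^sub>n, eta_bar = \<eta>_bar,
      eps_curv = \<epsilon>\<^sub>c\<^sub>u\<^sub>r\<^sub>v, eps_sr1 = \<epsilon>\<^sub>s\<^sub>r\<^sub>1, h_lo = h_low, h_hi = h_high, vth_0 = vtheta_0,
      upd = update \<rparr>"
    and run: "crdrs_run P f g z a x mem"
    and m: "m = 1 + \<gamma> * \<sigma>" and L: "L = 1 + \<gamma> * \<beta>"
    and theta: "\<theta>\<^sub>G = (L - m) / (L + m)" "\<theta> = max \<theta>\<^sub>Q (\<theta>\<^sub>G ^ b)"
    and Lp: "L\<^sub>p = 1 / m" and c: "c = 2 * \<alpha>"
    and M: "M = mat_of_rows_list 2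
      [[\<rho>, c],
       [\<theta> * L\<^sub>p * (1 + \<rho>), \<theta> * (1 + c * L\<^sub>p)]]"
  shows "\<exists>z_star x_star.
    {u. drs_map \<gamma> \<alpha> f g u = u} = {z_star} \<and>
    {u. is_arg_min (\<lambda>v. ereal (f v) + g v) (\<lambda>_. True) u} = {x_star} \<and>
    x_star = prox \<gamma> (\<lambda>v. ereal (f v)) z_star \<and>
    (let A = (\<lambda>k. norm (z k - z_star));
         E = (\<lambda>k. norm (x k - prox \<gamma> (\<lambda>v. ereal (f v)) (z k)));
         star_cond = \<theta> < (1 - \<rho>) / ((1 - \<rho>) * (1 + c * L\<^sub>p) + c * L\<^sub>p * (1 + \<rho>))
     in (star_cond \<longrightarrow> R_linear z z_star \<and> R_linear x x_star) \<and>
        (\<forall>k. vec_of_list [A (Suc k), E (Suc k)] \<le> M *\<^sub>v vec_of_list [A k, E k]) \<and>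
        (star_cond \<longleftrightarrow> spectral_radius (map_mat complex_of_real M) < 1))"
proof -
  have diff: "f differentiable at y" for y
    using f(2) unfolding twice_continuously_differentiable_def differentiable_def by blast
  interpret smooth: prox_smooth f \<sigma> \<beta> \<gamma>
    by unfold_locales (use diff f pos in auto)
  have P_sel: "gam P = \<gamma>" "sc P = \<sigma>" "sm P = \<beta>" "theta_Q P = \<theta>\<^sub>Q" "fb_steps P = b" "relax P = \<alpha>"
    by (simp_all add: P)
  have \<alpha>: "0 \<le> \<alpha>" using pos by simp
  have rho_lt: "\<bar>1 - \<alpha>\<bar> + \<alpha> * \<delta> < 1" using rho by simp
  obtain z_star where fixed: "drs_map \<gamma> \<alpha> f g z_star = z_star"
    and uniq: "\<And>u. drs_map \<gamma> \<alpha> f g u = u \<Longrightarrow> u = z_star"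
    using smooth.ex1_drs_fixed_point[OF g \<alpha> rho_lt[unfolded delta]] by blast
  define A where "A = (\<lambda>k. norm (z k - z_star))"
  define E where "E = (\<lambda>k. norm (x k - prox \<gamma> (\<lambda>v. ereal (f v)) (z k)))"
  have "0 \<le> \<rho>"
    unfolding rho(1) delta using smooth.delta_nonneg \<alpha> by (intro add_nonneg_nonneg mult_nonneg_nonneg) auto
  have "0 < \<theta>" using params by (simp add: theta less_max_iff_disj)
  have "0 < L\<^sub>p" unfolding Lp m using smooth.m_gt_1 by (intro divide_pos_pos) linarith+
  have "0 < c" using pos by (simp add: c)
  \<comment> \<open>The anchor of iteration \<open>Suc k\<close> is \<open>x k\<close>, so the error
    recursion links consecutive iterates from index 0 on, for any initial anchor.\<close>
  have step: "z (Suc k) = z k + (2 * \<alpha>) *\<^sub>R (prox \<gamma> g (2 *\<^sub>R x k - z k) - x k)"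
    and x_Suc: "x (Suc k) = corrected_point P f (mem (Suc k)) (z (Suc k)) (x k)" for k
    using run unfolding crdrs_run_def P_sel by metis+
  have x_err: "norm (x (Suc k) - prox \<gamma> (\<lambda>v. ereal (f v)) (z (Suc k)))
      \<le> \<theta> * norm (x k - prox \<gamma> (\<lambda>v. ereal (f v)) (z (Suc k)))" for k
    using smooth.corrected_point_error[OF P_sel(1-3), of "mem (Suc k)" "z (Suc k)" "x k"] params
    unfolding x_Suc[of k] theta m L P_sel by simp
  note recursion = smooth.error_recursion[OF g \<alpha> fixed step x_err less_imp_le[OF \<open>0 < \<theta>\<close>],
      folded delta rho(1)]
  have A_Suc: "A (Suc k) \<le> \<rho> * A k + c * E k" for k
    using recursion(1)[of k] by (simp only: A_def E_def c)
  have E_Suc: "E (Suc k) \<le> \<theta> * L\<^sub>p * (1 + \<rho>) * A k + \<theta> * (1 + c * L\<^sub>p) * E k" for k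
    using recursion(2)[of k] by (simp only: A_def E_def c Lp m)
  have pos_coeffs: "0 < \<theta> * L\<^sub>p * (1 + \<rho>)" "0 < \<theta> * (1 + c * L\<^sub>p)"
    using \<open>0 < \<theta>\<close> \<open>0 < L\<^sub>p\<close> \<open>0 < c\<close> \<open>0 \<le> \<rho>\<close> by (simp_all add: add_pos_nonneg)
  define star where
    "star \<longleftrightarrow> \<theta> < (1 - \<rho>) / ((1 - \<rho>) * (1 + c * L\<^sub>p) + c * L\<^sub>p * (1 + \<rho>))"
  \<comment> \<open>Clearing the positive denominator gives the determinant condition; its left side
    is positive, which forces the bound on the diagonal entry.\<close>
  have star_iff: "star \<longleftrightarrow> \<theta> * (1 + c * L\<^sub>p) < 1 \<and>
      c * (\<theta> * L\<^sub>p * (1 + \<rho>)) < (1 - \<rho>) * (1 - \<theta> * (1 + c * L\<^sub>p))"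
  proof -
    have "0 < (1 - \<rho>) * (1 + c * L\<^sub>p) + c * L\<^sub>p * (1 + \<rho>)"
      using rho(2) \<open>0 < L\<^sub>p\<close> \<open>0 < c\<close> \<open>0 \<le> \<rho>\<close> by (intro add_pos_nonneg mult_pos_pos) auto
    then have "star \<longleftrightarrow> \<theta> * ((1 - \<rho>) * (1 + c * L\<^sub>p) + c * L\<^sub>p * (1 + \<rho>)) < 1 - \<rho>"
      unfolding star_def by (rule pos_less_divide_eq)
    also have "\<dots> \<longleftrightarrow> c * (\<theta> * L\<^sub>p * (1 + \<rho>)) < (1 - \<rho>) * (1 - \<theta> * (1 + c * L\<^sub>p))"
      by (simp add: algebra_simps)
    finally have iff: "star \<longleftrightarrow> c * (\<theta> * L\<^sub>p * (1 + \<rho>)) < (1 - \<rho>) * (1 - \<theta> * (1 + c * L\<^sub>p))" .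
    have "\<theta> * (1 + c * L\<^sub>p) < 1" if star
    proof -
      have "0 < c * (\<theta> * L\<^sub>p * (1 + \<rho>))" using pos_coeffs(1) \<open>0 < c\<close> by (rule mult_pos_pos[rotated])
      then have "0 < (1 - \<rho>) * (1 - \<theta> * (1 + c * L\<^sub>p))" using that iff by linarith
      then show ?thesis using rho(2) by (simp add: zero_less_mult_iff)
    qed
    then show ?thesis using iff by blast
  qed
  let ?x_star = "prox \<gamma> (\<lambda>v. ereal (f v)) z_star"
  have R_lin: "R_linear z z_star \<and> R_linear x ?x_star" if star
  proof -
    have "\<exists>C>0. \<exists>q. 0 < q \<and> q < 1 \<and> (\<forall>k. A k \<le> C * q ^ k \<and> E k \<le> C * q ^ k)"
    proof (rule nonneg_2_recursion_geometric[OF \<open>0 \<le> \<rho>\<close> rho(2) \<open>0 < c\<close> pos_coeffs(1)])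
      show "\<theta> * (1 + c * L\<^sub>p) < 1"
        and "c * (\<theta> * L\<^sub>p * (1 + \<rho>)) < (1 - \<rho>) * (1 - \<theta> * (1 + c * L\<^sub>p))"
        using that star_iff by simp_all
      show "0 \<le> A k" "0 \<le> E k" for k by (simp_all add: A_def E_def)
    qed (fact A_Suc E_Suc)+
    then obtain C q where C: "0 < C" and q: "0 < q" "q < 1"
      and bound: "\<And>k. A k \<le> C * q ^ k" "\<And>k. E k \<le> C * q ^ k" by blast
    \<comment> \<open>The two parts of the constant come from \<open>E k\<close> and from the
      distance between \<open>P_f\<close> at \<open>z k\<close> and at \<open>z_star\<close>, at
      most \<open>L\<^sub>p * A k\<close>.\<close>
    have "norm (x k - ?x_star) \<le> (C + L\<^sub>p * C) * q ^ k" for k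
    proof -
      have "norm (x k - ?x_star) \<le> E k + norm (prox \<gamma> (\<lambda>v. ereal (f v)) (z k) - ?x_star)"
        using norm_triangle_ineq[of "x k - prox \<gamma> (\<lambda>v. ereal (f v)) (z k)"
            "prox \<gamma> (\<lambda>v. ereal (f v)) (z k) - ?x_star"]
        by (simp add: E_def)
      also have "norm (prox \<gamma> (\<lambda>v. ereal (f v)) (z k) - ?x_star) \<le> L\<^sub>p * A k"
        unfolding Lp m A_def by (rule smooth.P_f_lipschitz)
      also have "E k + L\<^sub>p * A k \<le> C * q ^ k + L\<^sub>p * (C * q ^ k)"
        using bound \<open>0 < L\<^sub>p\<close> by (intro add_mono mult_left_mono) auto
      finally show ?thesis by (simp add: algebra_simps)
    qed
    moreover have "0 < C + L\<^sub>p * C" using C \<open>0 < L\<^sub>p\<close> by (simp add: add_pos_pos)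
    ultimately have "R_linear x ?x_star" unfolding R_linear_def using q by blast
    moreover have "R_linear z z_star"
      unfolding R_linear_def using C q bound(1) unfolding A_def by blast
    ultimately show ?thesis by simp
  qed
  have componentwise: "vec_of_list [A (Suc k), E (Suc k)] \<le> M *\<^sub>v vec_of_list [A k, E k]" for k
    unfolding M mult_mat_vec_2 vec_of_list_2_le_iff using A_Suc E_Suc by blast
  have spectral: "star \<longleftrightarrow> spectral_radius (map_mat complex_of_real M) < 1"
    unfolding M star_iff
    by (rule spectral_radius_2_less_1_iff[symmetric])
      (use \<open>0 \<le> \<rho>\<close> rho(2) \<open>0 < c\<close> pos_coeffs in auto)
  have "{u. drs_map \<gamma> \<alpha> f g u = u} = {z_star}" using fixed uniq by blast
  moreover have "{u. is_arg_min (\<lambda>v. ereal (f v) + g v) (\<lambda>_. True) u} = {?x_star}"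
    by (rule smooth.minimizer_of_fixed_point[OF g _ fixed]) (use pos in simp)
  ultimately show ?thesis
    unfolding Let_def using R_lin componentwise spectral
    unfolding A_def E_def star_def by blast
qed

end
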